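(* Let $\Gamma$ be a finite directed rooted binary tree with $n_\Gamma$ edges and root edge $r$, let $K_e,H_e,a_e>0$ for $e\in\Gamma$, and let $\lambda>0$. Consider the process $\boldsymbol X=[\boldsymbol Q;\boldsymbol R]$ with spatially uniform rainfall described in the context, and suppose that the rainfall depths satisfy $P_1\sim\exp(\sigma)$ for some $\sigma>0$ (exponential distribution with rate $\sigma$, i.e. mean $1/\sigma$). Let $$M_r^*=\max\Big\{\sum_{e\in\Gamma}H_ea_e\,(\boldsymbol m_r(u))_e:\ u\in[0,1]\Big\}.$$ Then, under the invariant distribution $g$ of $\boldsymbol X$, $$\lim_{x\to\infty}\frac1x\log\mathbb P_g(Q_r>x)=-\frac{\sigma}{M_r^*}.$$
   Context: $\Gamma$ is a finite rooted binary tree modelling a river network: its $n_\Gamma$ edges are called links, $r$ is the root (most downstream) link, and each link $e$ either has two tributaries (the two links immediately upstream of it) or none. Vectors indexed by $\Gamma$ list the root first. The incidence matrix $\boldsymbol\Lambda_\Gamma\in\mathbb R^{n_\Gamma\times n_\Gamma}$ has $(\boldsymbol\Lambda_\Gamma)_{e,e}=1$ for all $e$, $(\boldsymbol\Lambda_\Gamma)_{e,e'}=-1$ if $e'$ is a tributary of $e$, and all other entries zero. Put $\mathbf K=\mathrm{diag}(K_e:e\in\Gamma)$, $\mathbf H=\mathrm{diag}(H_e:e\in\Gamma)$, $\boldsymbol a=[a_e:e\in\Gamma]^{\intercal}$, and $$\mathbf M=\begin{bmatrix}-\mathbf K\boldsymbol\Lambda_\Gamma&\mathbf K\\ \mathbf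 O&-\mathbf H\end{bmatrix}\in\mathbb R^{2n_\Gamma\times 2n_\Gamma}.$$ Let $N$ be a Poisson process with rate $\lambda$ and jump times $T_1<T_2<\cdots$, and let $P_n$, $n\ge1$, be i.i.d. positive random variables, independent of $N$ (spatially uniform rainfall: every link receives the same depth $P_n$ at time $T_n$). The process $\boldsymbol X$ solves $\mathrm d\boldsymbol X=\mathbf M\boldsymbol X\,\mathrm dt+\mathrm d\boldsymbol Y$ with $\boldsymbol Y(t)=\sum_{n=1}^{N(t)}\begin{bmatrix}\boldsymbol 0\\ \mathbf H\boldsymbol a\,P_n\end{bmatrix}$, i.e. $$\boldsymbol X(t)=\begin{bmatrix}\boldsymbol Q(t)\\ \boldsymbol R(t)\end{bmatrix}=e^{\mathbf Mt}\boldsymbol X(0)+\sum_{n=1}^{N(t)}e^{\mathbf M(t-T_n)}\begin{bmatrix}\boldsymbol 0\\ \mathbf H\boldsymbol a\,P_n\end{bmatrix},$$ with $\boldsymbol Q=[Q_e:e\in\Gamma]^{\intercal}$, $\boldsymbol R=[R_e:e\in\Gamma]^{\intercal}$ and state space $(0,\infty)^{2n_\Gamma}$. A probability distribution is invariant for $\boldsymbol X$ if $\boldsymbol X(t)$ has that distribution for all $t>0$ whenever $\boldsymbol X(0)$ does (with $\boldsymbol X(0)$ independent of $\boldsymbol Y$). A unique invariant distribution $g$ exists whenever $\mathbb E[\max(\log P_1,0)]<\infty$, which is the case here; $\mathbb P_g$ denotes probability under it. For $u\in(0,1]$, $u^{-\mathbf M^{\intercal}/H_r}:=\exp\big(-\tfrac{\log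 u}{H_r}\mathbf M^{\intercal}\big)$, and $\boldsymbol m_r(u)\in\mathbb R^{n_\Gamma}$ consists of the last $n_\Gamma$ entries of its first column (the column corresponding to $Q_r$); $\boldsymbol m_r(0):=\lim_{u\downarrow0}\boldsymbol m_r(u)=\boldsymbol 0$. *)

theory Defs
  imports "HOL-Probability.Probability"
begin

section \<open>River networks\<close>

text \<open>
  A river network is given by its set of links, here a whole finite type \<open>'e\<close>, its root link
  \<open>r\<close>, and the set \<open>trib e\<close> of tributaries (immediately upstream links) of each link \<open>e\<close>.
\<close>

definition rooted_binary_tree :: "'e::finite \<Rightarrow> ('e \<Rightarrow> 'e set) \<Rightarrow> bool" where
  "rooted_binary_tree r trib \<longleftrightarrow>
     (\<forall>e. trib e = {} \<or> card (trib e) = 2) \<and>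
     (\<forall>e. r \<notin> trib e) \<and>
     (\<forall>e. e \<noteq> r \<longrightarrow> (\<exists>!e'. e \<in> trib e')) \<and>
     (\<forall>e. (r, e) \<in> {(e1, e2). e2 \<in> trib e1}\<^sup>*)"

definition incidence_matrix :: "('e::finite \<Rightarrow> 'e set) \<Rightarrow> real^'e^'e" where
  "incidence_matrix trib =
     (\<chi> e e'. if e' = e then 1 else if e' \<in> trib e then - 1 else 0)"


section \<open>Matrices\<close>

definition diag_matrix :: "real^'n \<Rightarrow> real^'n^'n" where
  "diag_matrix v = (\<chi> i j. if i = j then v $ i else 0)"

definition block_matrix ::
    "real^'n^'m \<Rightarrow> real^'p^'m \<Rightarrow> real^'n^'q \<Rightarrow> real^'p^'q \<Rightarrow> real^('n + 'p)^('m + 'q)" where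
  "block_matrix A B C D =
     (\<chi> i j. case i of
        Inl k \<Rightarrow> (case j of Inl l \<Rightarrow> A $ k $ l | Inr l \<Rightarrow> B $ k $ l)
      | Inr k \<Rightarrow> (case j of Inl l \<Rightarrow> C $ k $ l | Inr l \<Rightarrow> D $ k $ l))"

definition block_vector :: "real^'n \<Rightarrow> real^'p \<Rightarrow> real^('n + 'p)" where
  "block_vector v w = (\<chi> i. case i of Inl k \<Rightarrow> v $ k | Inr k \<Rightarrow> w $ k)"

primrec matrix_power :: "real^'n^'n \<Rightarrow> nat \<Rightarrow> real^'n^'n" where
  "matrix_power A 0 = mat 1"
| "matrix_power A (Suc k) = A ** matrix_power A k"

text \<open>
  The product of \<^typ>\<open>real^'n^'n\<close> as an algebra is componentwise, so the overloaded power
  and exponential are not the matrix ones.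
\<close>

definition matrix_exp :: "real^'n^'n \<Rightarrow> real^'n^'n" where
  "matrix_exp A = (\<Sum>k. (1 / fact k) *\<^sub>R matrix_power A k)"


section \<open>Poisson processes\<close>

text \<open>Only the values of the process at times \<open>t \<ge> 0\<close> are relevant.\<close>

definition (in prob_space) poisson_process :: "real \<Rightarrow> (real \<Rightarrow> 'a \<Rightarrow> nat) \<Rightarrow> bool" where
  "poisson_process rate N \<longleftrightarrow>
     (\<forall>t\<ge>0. random_variable (count_space UNIV) (N t)) \<and>
     (\<forall>\<omega>\<in>space M. N 0 \<omega> = 0 \<and> mono_on {0..} (\<lambda>t. N t \<omega>) \<and>
        (\<forall>t\<ge>0. ((\<lambda>s. N s \<omega>) \<longlongrightarrow> N t \<omega>) (at_right t))) \<and>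
     (\<forall>\<tau>::nat \<Rightarrow> real. 0 \<le> \<tau> 0 \<and> mono \<tau> \<longrightarrow>
        indep_vars (\<lambda>_. count_space UNIV) (\<lambda>i \<omega>. N (\<tau> (Suc i)) \<omega> - N (\<tau> i) \<omega>) UNIV) \<and>
     (\<forall>s t. 0 \<le> s \<and> s < t \<longrightarrow>
        distr M (count_space UNIV) (\<lambda>\<omega>. N t \<omega> - N s \<omega>)
          = measure_pmf (poisson_pmf (rate * (t - s))))"

text \<open>The time \<open>T\<^sub>n\<close> of the \<open>n\<close>-th jump, for \<open>n \<ge> 1\<close>.\<close>

definition jump_time :: "(real \<Rightarrow> 'w \<Rightarrow> nat) \<Rightarrow> nat \<Rightarrow> 'w \<Rightarrow> real" where
  "jump_time N n \<omega> = Inf {t. 0 \<le> t \<and> n \<le> N t \<omega>}"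

text \<open>
  I.i.d.\ positive rainfall depths \<open>P\<^sub>n\<close>, \<open>n \<ge> 1\<close> (the value \<open>P 0\<close> is not used), the sequence being
  independent of the whole process \<open>N\<close>.
\<close>

definition (in prob_space) rainfall_depths ::
    "(real \<Rightarrow> 'a \<Rightarrow> nat) \<Rightarrow> (nat \<Rightarrow> 'a \<Rightarrow> real) \<Rightarrow> bool" where
  "rainfall_depths N P \<longleftrightarrow>
     indep_vars (\<lambda>_. borel) P {1..} \<and>
     (\<forall>n\<ge>1. distr M borel (P n) = distr M borel (P 1)) \<and>
     (\<forall>n\<ge>1. AE \<omega> in M. 0 < P n \<omega>) \<and>
     indep_var (PiM {0..} (\<lambda>_. count_space UNIV)) (\<lambda>\<omega>. \<lambda>t\<in>{0..}. N t \<omega>)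
               (PiM {1..} (\<lambda>_. borel)) (\<lambda>\<omega>. \<lambda>n\<in>{1..}. P n \<omega>)"


section \<open>The river process\<close>

text \<open>
  The state \<open>X = [Q; R]\<close> is indexed by \<^typ>\<open>'e + 'e\<close>: the entries at \<^term>\<open>Inl e\<close> and
  \<^term>\<open>Inr e\<close> are \<open>Q\<^sub>e\<close> and \<open>R\<^sub>e\<close>.
\<close>

definition drift_matrix ::
    "('e::finite \<Rightarrow> 'e set) \<Rightarrow> real^'e \<Rightarrow> real^'e \<Rightarrow> real^('e + 'e)^('e + 'e)" where
  "drift_matrix trib K H =
     block_matrix (- (diag_matrix K ** incidence_matrix trib)) (diag_matrix K)
                  0 (- diag_matrix H)"

text \<open>
  The solution, started at \<open>x\<close>, of \<open>dX = A X dt + dY\<close> where \<open>Y\<close> jumps by \<open>P\<^sub>n b\<close> at time \<open>T\<^sub>n\<close>.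
\<close>

definition shot_noise_state ::
    "real^'n^'n \<Rightarrow> real^'n \<Rightarrow> (real \<Rightarrow> 'w \<Rightarrow> nat) \<Rightarrow> (nat \<Rightarrow> 'w \<Rightarrow> real)
      \<Rightarrow> real^'n \<Rightarrow> real \<Rightarrow> 'w \<Rightarrow> real^'n" where
  "shot_noise_state A b N P x t \<omega> =
     matrix_exp (t *\<^sub>R A) *v x +
     (\<Sum>n = 1..N t \<omega>. matrix_exp ((t - jump_time N n \<omega>) *\<^sub>R A) *v (P n \<omega> *\<^sub>R b))"

definition river_process ::
    "('e::finite \<Rightarrow> 'e set) \<Rightarrow> real^'e \<Rightarrow> real^'e \<Rightarrow> real^'e
      \<Rightarrow> (real \<Rightarrow> 'w \<Rightarrow> nat) \<Rightarrow> (nat \<Rightarrow> 'w \<Rightarrow> real)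
      \<Rightarrow> real^('e + 'e) \<Rightarrow> real \<Rightarrow> 'w \<Rightarrow> real^('e + 'e)" where
  "river_process trib K H a =
     shot_noise_state (drift_matrix trib K H) (block_vector 0 (diag_matrix H *v a))"

text \<open>
  Invariance of \<open>g\<close> for a process on the state space \<open>(0, \<infinity>)\<^sup>n\<close> driven by noise living on the
  probability space \<open>\<Omega>\<close>.  A start \<open>X(0)\<close> with law \<open>g\<close> that is independent of the noise is realised
  by the first projection of the product space \<^term>\<open>g \<Otimes>\<^sub>M \<Omega>\<close>; \<open>\<Omega>\<close> itself need not be rich enough
  to carry such a variable.
\<close>

definition invariant_distribution ::
    "'w measure \<Rightarrow> (real^'n \<Rightarrow> real \<Rightarrow> 'w \<Rightarrow> real^'n) \<Rightarrow> (real^'n) measure \<Rightarrow> bool" where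
  "invariant_distribution \<Omega> X g \<longleftrightarrow>
     prob_space g \<and> sets g = sets borel \<and>
     (AE x in g. \<forall>i. 0 < x $ i) \<and>
     (\<forall>t>0. distr (g \<Otimes>\<^sub>M \<Omega>) borel (\<lambda>(x, \<omega>). X x t \<omega>) = g)"


section \<open>The extremal response at the root\<close>

text \<open>
  For \<open>0 < u \<le> 1\<close>, the last \<open>n\<^sub>\<Gamma>\<close> entries of the \<open>Q\<^sub>r\<close>-column of \<open>u\<close> to the power
  \<open>- M\<^sup>T / H\<^sub>r\<close>; the value at \<open>u = 0\<close> is the limit, the zero vector.
\<close>

definition response_vector ::
    "('e::finite \<Rightarrow> 'e set) \<Rightarrow> real^'e \<Rightarrow> real^'e \<Rightarrow> 'e \<Rightarrow> real \<Rightarrow> real^'e" where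
  "response_vector trib K H r u =
     (if u = 0 then 0
      else (\<chi> e. matrix_exp ((- (ln u / H $ r)) *\<^sub>R transpose (drift_matrix trib K H))
                   $ Inr e $ Inl r))"

definition max_response ::
    "('e::finite \<Rightarrow> 'e set) \<Rightarrow> real^'e \<Rightarrow> real^'e \<Rightarrow> real^'e \<Rightarrow> 'e \<Rightarrow> real" where
  "max_response trib K H a r =
     (GREATEST y. y \<in> (\<lambda>u. \<Sum>e\<in>UNIV. H $ e * a $ e * response_vector trib K H r u $ e) ` {0..1})"

end

(*
  The matrix M is Metzler and exponentially stable, so the response f(s) at the root, s time units
  after a unit storm, is nonnegative, decays exponentially and attains its maximum over s >= 0, which
  is the constant M_r^* of the theorem (substitute u = exp (- H_r s)).

  Lower bound: one storm of depth x / l with l < M_r^*, observed when f exceeds l, already gives Q_r > x,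
  and a fixed time is as good as any other under the invariant distribution.

  Upper bound: for theta M_r^* < sigma the exponential moment of theta times the accumulated response
  is bounded uniformly in time; it is estimated by replacing f by its supremum over unit intervals,
  and the geometric decay of these suprema suffices.  Letting time tend to infinity removes the
  initial state.
*)
theory Submission
  imports Defs
begin

section \<open>Matrix exponentials\<close>

text \<open>Given the counts of storms in unit intervals, a depth with weight c has exponential
  moment \<sigma> / (\<sigma> - c), finite exactly for c < \<sigma>; this is where the threshold
  \<theta> M_r^* < \<sigma> comes from. Averaging over the Poisson counts turns the product of these
  factors into exp (rate * sum of c / (\<sigma> - c)), so only convergence of the sum of the weights
  remains to be checked. It follows from stability, which is made explicit: a positive vector with
  weights shrinking geometrically upstream is mapped by M below a negative multiple of itself, and
  nonnegativity of the exponential turns this into a bound for every entry.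

  In the lower bound the age of the storm is random. The event is reduced to a storm by time 1
  together with a large \<open>P 1\<close>, whose probability factors and decays like exp (-
  \<sigma> x / l); the unknown age is compensated by observing at finitely many times. The tail of g
  dominates each of these observations, so only a constant factor is lost, which disappears after
  taking logarithms and dividing by x.\<close>

lemma matrix_vector_mult_nth: "(A *v x) $ i = (\<Sum>j\<in>UNIV. A $ i $ j * x $ j)"
  by (simp add: matrix_vector_mult_def)

lemma matrix_power_Suc_nth:
  "matrix_power A (Suc k) $ i $ j = (\<Sum>l\<in>UNIV. A $ i $ l * matrix_power A k $ l $ j)"
  by (simp add: matrix_matrix_mult_def)

lemma matrix_power_commute: "A ** matrix_power A k = matrix_power A k ** A"
  by (induction k) (simp_all add: matrix_mul_assoc)

lemma matrix_power_transpose: "matrix_power (transpose A) k = transpose (matrix_power A k)"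
  by (induction k) (simp_all add: matrix_transpose_mul matrix_power_commute)

lemma matrix_power_scaleR: "matrix_power (s *\<^sub>R A) k = s ^ k *\<^sub>R matrix_power A k"
proof (induction k)
  case (Suc k)
  then show ?case
    by (simp add: vec_eq_iff matrix_matrix_mult_def sum_distrib_left algebra_simps)
qed simp

text \<open>The sum of the absolute values of all entries is submultiplicative and dominates each
  entry. This crude bound suffices for absolute convergence of the entrywise exponential
  series.\<close>

lemma matrix_power_nth_bound:
  fixes A :: "real^'n^'n"
  shows "\<bar>matrix_power A k $ i $ j\<bar> \<le> (\<Sum>i\<in>UNIV. \<Sum>j\<in>UNIV. \<bar>A $ i $ j\<bar>) ^ k"
proof (induction k arbitrary: i)
  case 0
  then show ?case by (simp add: mat_def)
next
  case (Suc k)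
  let ?L = "\<Sum>i\<in>UNIV. \<Sum>j\<in>UNIV. \<bar>A $ i $ j\<bar>"
  have "\<bar>matrix_power A (Suc k) $ i $ j\<bar> \<le> (\<Sum>l\<in>UNIV. \<bar>A $ i $ l\<bar> * \<bar>matrix_power A k $ l $ j\<bar>)"
    unfolding matrix_power_Suc_nth abs_mult[symmetric] by (rule sum_abs)
  also have "\<dots> \<le> (\<Sum>l\<in>UNIV. \<bar>A $ i $ l\<bar> * ?L ^ k)"
    by (intro sum_mono mult_left_mono Suc) auto
  also have "\<dots> \<le> ?L * ?L ^ k"
    unfolding sum_distrib_right[symmetric]
    by (intro mult_right_mono zero_le_power sum_nonneg
        member_le_sum[where f="\<lambda>i. \<Sum>j\<in>UNIV. \<bar>A $ i $ j\<bar>"]) (auto intro: sum_nonneg)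
  finally show ?case by simp
qed

lemma summable_norm_matrix_power:
  fixes A :: "real^'n^'n" and s :: real
  shows "summable (\<lambda>k. norm (matrix_power A k $ i $ j / fact k * s ^ k))"
proof (rule summable_comparison_test')
  let ?L = "\<Sum>i\<in>UNIV. \<Sum>j\<in>UNIV. \<bar>A $ i $ j\<bar>"
  show "summable (\<lambda>k. inverse (fact k) * (?L * \<bar>s\<bar>) ^ k)"
    by (rule summable_exp)
  show "norm (norm (matrix_power A k $ i $ j / fact k * s ^ k)) \<le> inverse (fact k) * (?L * \<bar>s\<bar>) ^ k"
    for k
    using mult_right_mono[OF matrix_power_nth_bound[of A k i j], of "inverse (fact k) * \<bar>s\<bar> ^ k"]
    by (simp add: abs_mult power_abs power_mult_distrib field_simps)
qed

text \<open>Each entry is a scalar power series in \<open>s\<close>; transposition, continuity,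
  positivity and decay of the exponential are all derived from this representation.\<close>

lemma matrix_exp_sums:
  fixes A :: "real^'n^'n" and s :: real
  shows "(\<lambda>k. matrix_power A k $ i $ j / fact k * s ^ k) sums (matrix_exp (s *\<^sub>R A) $ i $ j)"
proof -
  define S :: "real^'n^'n" where "S = (\<chi> i j. \<Sum>k. matrix_power A k $ i $ j / fact k * s ^ k)"
  have entry: "(\<lambda>k. matrix_power A k $ i $ j / fact k * s ^ k) sums S $ i $ j" for i j
    unfolding S_def vec_lambda_beta
    by (intro summable_sums summable_norm_cancel[OF summable_norm_matrix_power])
  have "(\<lambda>k. (1 / fact k) *\<^sub>R matrix_power (s *\<^sub>R A) k) sums S"
    unfolding sums_def
  proof (intro vec_tendstoI)
    show "(\<lambda>n. (\<Sum>k<n. (1 / fact k) *\<^sub>R matrix_power (s *\<^sub>R A) k) $ i $ j) \<longlonglongrightarrow> S $ i $ j" for i j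
      using entry[of i j] by (simp add: sums_def matrix_power_scaleR mult.commute)
  qed
  then have "matrix_exp (s *\<^sub>R A) = S"
    unfolding matrix_exp_def by (rule sums_unique[symmetric])
  then show ?thesis
    using entry by simp
qed

text \<open>The response vector is read from a column of the exponential of the transpose, the
  process from a row of the exponential itself.\<close>

lemma matrix_exp_transpose: "matrix_exp (s *\<^sub>R transpose A) $ i $ j = matrix_exp (s *\<^sub>R A) $ j $ i"
proof (rule sums_unique2)
  show "(\<lambda>k. matrix_power A k $ j $ i / fact k * s ^ k) sums matrix_exp (s *\<^sub>R transpose A) $ i $ j"
    using matrix_exp_sums[of "transpose A" i j s, unfolded matrix_power_transpose]
    by (simp add: transpose_def)
qed (rule matrix_exp_sums)

lemma isCont_matrix_exp_nth:
  fixes A :: "real^'n^'n"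
  shows "isCont (\<lambda>s. matrix_exp (s *\<^sub>R A) $ i $ j) s"
proof -
  have "isCont (\<lambda>s. \<Sum>k. matrix_power A k $ i $ j / fact k * s ^ k) s"
    by (intro isCont_powser_converges_everywhere summable_norm_cancel[OF summable_norm_matrix_power])
  then show ?thesis
    by (simp add: sums_unique[OF matrix_exp_sums])
qed

lemma borel_measurable_matrix_exp_nth [measurable]:
  "(\<lambda>s. matrix_exp (s *\<^sub>R A) $ i $ j) \<in> borel_measurable borel"
  by (intro borel_measurable_continuous_onI continuous_at_imp_continuous_on ballI
      isCont_matrix_exp_nth)

text \<open>The binomial theorem applies because multiples of the identity commute with
  \<open>A\<close>.\<close>

lemma matrix_power_add_scalar:
  fixes A :: "real^'n^'n"
  shows "matrix_power (A + \<kappa> *\<^sub>R mat 1) k =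
    (\<Sum>i\<le>k. (real (k choose i) * \<kappa> ^ i) *\<^sub>R matrix_power A (k - i))"
proof (induction k)
  case (Suc k)
  let ?g = "\<lambda>k i. (real (k choose i) * \<kappa> ^ i) *\<^sub>R matrix_power A (k - i)"
  have mult: "(A + \<kappa> *\<^sub>R mat 1) ** C = A ** C + \<kappa> *\<^sub>R C" for C
    by (simp add: matrix_eq matrix_vector_mult_add_rdistrib
        flip: matrix_vector_mul_assoc scaleR_matrix_vector_assoc)
  have lin: "A ** (\<Sum>i\<in>I. F i) = (\<Sum>i\<in>I. A ** F i)" for F :: "nat \<Rightarrow> real^'n^'n" and I
    by (induction I rule: infinite_finite_induct) (simp_all add: matrix_add_ldistrib)
  have "matrix_power (A + \<kappa> *\<^sub>R mat 1) (Suc k) = (\<Sum>i\<le>k. A ** ?g k i) + (\<Sum>i\<le>k. \<kappa> *\<^sub>R ?g k i)"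
    by (simp add: Suc mult lin scaleR_sum_right)
  also have "(\<Sum>i\<le>k. A ** ?g k i) =
      (\<Sum>i\<le>k. (real (k choose i) * \<kappa> ^ i) *\<^sub>R matrix_power A (Suc k - i))"
    by (intro sum.cong refl) (simp add: matrix_scalar_ac scalar_matrix_assoc Suc_diff_le)
  \<comment> \<open>The term added at \<open>Suc k\<close> vanishes because
    \<open>k choose Suc k\<close> is 0; the longer sum can be split at its first term and
    shifted.\<close>
  also have "\<dots> = (\<Sum>i\<le>Suc k. (real (k choose i) * \<kappa> ^ i) *\<^sub>R matrix_power A (Suc k - i))"
    by simp
  also have "\<dots> = matrix_power A (Suc k) +
      (\<Sum>i\<le>k. (real (k choose Suc i) * \<kappa> ^ Suc i) *\<^sub>R matrix_power A (k - i))"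
    by (subst sum.atMost_Suc_shift) simp
  also have "(\<Sum>i\<le>k. \<kappa> *\<^sub>R ?g k i) =
      (\<Sum>i\<le>k. (real (k choose i) * \<kappa> ^ Suc i) *\<^sub>R matrix_power A (k - i))"
    by (simp add: algebra_simps)
  \<comment> \<open>Pascal's rule merges the two sums.\<close>
  also have "matrix_power A (Suc k)
        + (\<Sum>i\<le>k. (real (k choose Suc i) * \<kappa> ^ Suc i) *\<^sub>R matrix_power A (k - i))
        + (\<Sum>i\<le>k. (real (k choose i) * \<kappa> ^ Suc i) *\<^sub>R matrix_power A (k - i)) =
      matrix_power A (Suc k) + (\<Sum>i\<le>k. ?g (Suc k) (Suc i))"
    by (simp add: algebra_simps flip: sum.distrib scaleR_add_left)
  also have "\<dots> = (\<Sum>i\<le>Suc k. ?g (Suc k) i)"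
    by (subst sum.atMost_Suc_shift) simp
  finally show ?case .
qed simp

text \<open>Cauchy product of the two exponential series. A Metzler matrix becomes entrywise
  nonnegative after such a shift, at the price of a positive scalar factor.\<close>

lemma matrix_exp_add_scalar:
  fixes A :: "real^'n^'n"
  shows "matrix_exp (s *\<^sub>R (A + \<kappa> *\<^sub>R mat 1)) $ i $ j = exp (\<kappa> * s) * matrix_exp (s *\<^sub>R A) $ i $ j"
proof -
  let ?a = "\<lambda>k. (\<kappa> * s) ^ k /\<^sub>R fact k" and ?b = "\<lambda>k. matrix_power A k $ i $ j / fact k * s ^ k"
  have "(\<lambda>k. \<Sum>l\<le>k. ?a l * ?b (k - l)) sums ((\<Sum>k. ?a k) * (\<Sum>k. ?b k))"
    by (intro Cauchy_product_sums summable_norm_exp summable_norm_matrix_power)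
  also have "(\<Sum>k. ?a k) = exp (\<kappa> * s)"
    by (simp add: exp_def)
  also have "(\<Sum>k. ?b k) = matrix_exp (s *\<^sub>R A) $ i $ j"
    by (rule sums_unique[OF matrix_exp_sums, symmetric])
  also have "(\<lambda>k. \<Sum>l\<le>k. ?a l * ?b (k - l)) =
      (\<lambda>k. matrix_power (A + \<kappa> *\<^sub>R mat 1) k $ i $ j / fact k * s ^ k)"
  proof
    fix k
    show "(\<Sum>l\<le>k. ?a l * ?b (k - l)) =
        matrix_power (A + \<kappa> *\<^sub>R mat 1) k $ i $ j / fact k * s ^ k"
      unfolding matrix_power_add_scalar sum_component sum_divide_distrib sum_distrib_right
      by (intro sum.cong refl)
        (simp add: binomial_fact power_mult_distrib field_simps flip: power_add)
  qed
  finally show ?thesis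
    using matrix_exp_sums sums_unique2 by blast
qed

section \<open>Positivity and decay for Metzler matrices\<close>

lemma matrix_power_nonneg:
  fixes A :: "real^'n^'n"
  assumes "\<And>i j. 0 \<le> A $ i $ j"
  shows "0 \<le> matrix_power A k $ i $ j"
proof (induction k arbitrary: i)
  case 0
  then show ?case by (simp add: mat_def)
next
  case (Suc k)
  then show ?case
    unfolding matrix_power_Suc_nth by (intro sum_nonneg mult_nonneg_nonneg assms)
qed

definition metzler :: "real^'n^'n \<Rightarrow> bool" where
  "metzler A \<longleftrightarrow> (\<forall>i j. i \<noteq> j \<longrightarrow> 0 \<le> A $ i $ j)"

text \<open>Any shift beyond all \<open>\<bar>A $ i $ i\<bar>\<close> clears the diagonal. The
  prescribed lower bound \<open>c\<close> serves the decay estimate, where powers of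
  \<open>\<kappa> - c\<close> must be nonnegative.\<close>

lemma metzler_shift:
  fixes A :: "real^'n^'n"
  assumes "metzler A"
  obtains \<kappa> where "c \<le> \<kappa>" "\<And>i j. 0 \<le> (A + \<kappa> *\<^sub>R mat 1) $ i $ j"
proof
  let ?\<kappa> = "\<bar>c\<bar> + (\<Sum>i\<in>UNIV. \<bar>A $ i $ i\<bar>)"
  show "c \<le> ?\<kappa>"
    by (intro add_increasing2 sum_nonneg) auto
  show "0 \<le> (A + ?\<kappa> *\<^sub>R mat 1) $ i $ j" for i j
    using assms member_le_sum[of i UNIV "\<lambda>i. \<bar>A $ i $ i\<bar>"]
    by (cases "i = j") (auto simp: metzler_def mat_def)
qed

text \<open>After the shift every term of the series is nonnegative, and the factor
  \<open>exp (\<kappa> * s)\<close> does not affect the sign.\<close>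

lemma matrix_exp_nonneg:
  assumes "metzler A" "0 \<le> s"
  shows "0 \<le> matrix_exp (s *\<^sub>R A) $ i $ j"
proof -
  obtain \<kappa> where \<kappa>: "\<And>i j. 0 \<le> (A + \<kappa> *\<^sub>R mat 1) $ i $ j"
    using metzler_shift[OF assms(1)] by blast
  have "0 \<le> matrix_exp (s *\<^sub>R (A + \<kappa> *\<^sub>R mat 1)) $ i $ j"
    by (rule sums_le[OF _ sums_zero matrix_exp_sums])
      (intro mult_nonneg_nonneg divide_nonneg_nonneg matrix_power_nonneg \<kappa> zero_le_power assms(2), simp)
  then show ?thesis
    by (simp add: matrix_exp_add_scalar zero_le_mult_iff)
qed

text \<open>The linear term of the series is already positive: off the diagonal the shift leaves
  \<open>A $ i $ j\<close> unchanged.\<close>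

lemma matrix_exp_pos:
  assumes "metzler A" "0 < s" "i \<noteq> j" "0 < A $ i $ j"
  shows "0 < matrix_exp (s *\<^sub>R A) $ i $ j"
proof -
  obtain \<kappa> where \<kappa>: "\<And>i j. 0 \<le> (A + \<kappa> *\<^sub>R mat 1) $ i $ j"
    using metzler_shift[OF assms(1)] by blast
  let ?B = "A + \<kappa> *\<^sub>R mat 1"
  have "0 < matrix_exp (s *\<^sub>R ?B) $ i $ j"
    unfolding sums_unique[OF matrix_exp_sums]
  proof (rule suminf_pos2)
    show "summable (\<lambda>k. matrix_power ?B k $ i $ j / fact k * s ^ k)"
      by (rule sums_summable[OF matrix_exp_sums])
    show "0 \<le> matrix_power ?B k $ i $ j / fact k * s ^ k" for k
      using matrix_power_nonneg[OF \<kappa>] assms(2) by simp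
    show "0 < matrix_power ?B 1 $ i $ j / fact 1 * s ^ 1"
      using assms by (simp add: matrix_mul_rid) (simp add: mat_def)
  qed
  then show ?thesis
    by (simp add: matrix_exp_add_scalar zero_less_mult_iff)
qed

text \<open>For the nonnegative matrix \<open>B = A + \<kappa> *\<^sub>R mat 1\<close> the
  inequality \<open>B w \<le> (\<kappa> - c) w\<close> iterates to all powers, hence passes to the
  exponential series; undoing the shift leaves the rate \<open>c\<close>. Since all summands are
  nonnegative, a single entry is bounded by the weighted row sum.\<close>

lemma matrix_exp_decay:
  fixes A :: "real^'n^'n"
  assumes "metzler A" "0 \<le> s" and w: "\<And>i. 0 < w $ i" "\<And>i. (A *v w) $ i \<le> - c * w $ i"
  shows "matrix_exp (s *\<^sub>R A) $ i $ j \<le> exp (- c * s) * (w $ i / w $ j)"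
proof -
  obtain \<kappa> where \<kappa>: "c \<le> \<kappa>" "\<And>i j. 0 \<le> (A + \<kappa> *\<^sub>R mat 1) $ i $ j"
    using metzler_shift[OF assms(1)] by blast
  define B where "B = A + \<kappa> *\<^sub>R mat 1"
  have Bw: "(B *v w) $ i \<le> (\<kappa> - c) * w $ i" for i
    using w(2)[of i] by (simp add: B_def matrix_vector_mult_add_rdistrib scaleR_matrix_vector_assoc[symmetric]
        left_diff_distrib)
  have pow: "(\<Sum>j\<in>UNIV. matrix_power B k $ i $ j * w $ j) \<le> (\<kappa> - c) ^ k * w $ i" for k i
  proof (induction k arbitrary: i)
    case 0
    then show ?case
      by (simp add: mat_def if_distrib[of "\<lambda>x. x * _"] cong: if_cong)
  next
    case (Suc k)
    have "(\<Sum>j\<in>UNIV. matrix_power B (Suc k) $ i $ j * w $ j) =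
        (\<Sum>l\<in>UNIV. B $ i $ l * (\<Sum>j\<in>UNIV. matrix_power B k $ l $ j * w $ j))"
      unfolding matrix_power_Suc_nth sum_distrib_left sum_distrib_right
      by (subst sum.swap) (simp add: mult.assoc)
    also have "\<dots> \<le> (\<Sum>l\<in>UNIV. B $ i $ l * ((\<kappa> - c) ^ k * w $ l))"
      by (intro sum_mono mult_left_mono Suc) (use \<kappa>(2) in \<open>simp add: B_def\<close>)
    also have "\<dots> = (\<kappa> - c) ^ k * (B *v w) $ i"
      by (simp add: matrix_vector_mult_nth sum_distrib_left algebra_simps)
    also have "\<dots> \<le> (\<kappa> - c) ^ k * ((\<kappa> - c) * w $ i)"
      by (intro mult_left_mono Bw) (simp add: \<kappa>)
    finally show ?case
      by (simp add: algebra_simps)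
  qed
  have "(\<Sum>j\<in>UNIV. matrix_exp (s *\<^sub>R B) $ i $ j * w $ j) \<le> exp ((\<kappa> - c) * s) * w $ i"
  proof (rule sums_le)
    show "(\<lambda>k. \<Sum>j\<in>UNIV. matrix_power B k $ i $ j / fact k * s ^ k * w $ j) sums
        (\<Sum>j\<in>UNIV. matrix_exp (s *\<^sub>R B) $ i $ j * w $ j)"
      by (intro sums_sum sums_mult2 matrix_exp_sums)
    show "(\<lambda>k. ((\<kappa> - c) * s) ^ k /\<^sub>R fact k * w $ i) sums (exp ((\<kappa> - c) * s) * w $ i)"
      by (intro sums_mult2 exp_converges)
    show "(\<Sum>j\<in>UNIV. matrix_power B k $ i $ j / fact k * s ^ k * w $ j) \<le>
        ((\<kappa> - c) * s) ^ k /\<^sub>R fact k * w $ i" for k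
    proof -
      have "(\<Sum>j\<in>UNIV. matrix_power B k $ i $ j / fact k * s ^ k * w $ j) =
          s ^ k / fact k * (\<Sum>j\<in>UNIV. matrix_power B k $ i $ j * w $ j)"
        by (simp add: sum_distrib_left mult_ac)
      also have "\<dots> \<le> s ^ k / fact k * ((\<kappa> - c) ^ k * w $ i)"
        by (intro mult_left_mono pow) (simp add: assms(2))
      also have "\<dots> = ((\<kappa> - c) * s) ^ k /\<^sub>R fact k * w $ i"
        unfolding power_mult_distrib by (simp add: divide_inverse mult_ac)
      finally show ?thesis .
    qed
  qed
  moreover have "matrix_exp (s *\<^sub>R B) $ i $ j * w $ j \<le>
      (\<Sum>j\<in>UNIV. matrix_exp (s *\<^sub>R B) $ i $ j * w $ j)"
    using assms(2) matrix_exp_nonneg[OF assms(1), of s i] w(1)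
    by (intro member_le_sum[where f="\<lambda>j. matrix_exp (s *\<^sub>R B) $ i $ j * w $ j"])
      (auto simp: B_def matrix_exp_add_scalar intro!: mult_nonneg_nonneg less_imp_le[OF w(1)])
  moreover have "exp ((\<kappa> - c) * s) = exp (\<kappa> * s) * exp (- c * s)"
    by (simp add: algebra_simps flip: exp_add)
  ultimately have "exp (\<kappa> * s) * (matrix_exp (s *\<^sub>R A) $ i $ j * w $ j) \<le>
      exp (\<kappa> * s) * (exp (- c * s) * w $ i)"
    by (simp only: B_def matrix_exp_add_scalar mult.assoc)
  then show ?thesis
    using w(1)[of j] by (simp add: field_simps)
qed

section \<open>The impulse response at the root\<close>

lemma sum_UNIV_plus:
  "(\<Sum>x\<in>UNIV. f x) = (\<Sum>x\<in>UNIV. f (Inl x)) + (\<Sum>x\<in>UNIV. f (Inr x :: 'a::finite + 'b::finite))"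
  unfolding UNIV_Plus_UNIV[symmetric] by (subst sum.Plus) auto

lemma diag_matrix_mult_nth: "(diag_matrix v ** A) $ i $ j = v $ i * A $ i $ j"
proof -
  have "(diag_matrix v ** A) $ i $ j = (\<Sum>k\<in>UNIV. if i = k then v $ i * A $ k $ j else 0)"
    unfolding matrix_matrix_mult_def diag_matrix_def vec_lambda_beta by (intro sum.cong) auto
  then show ?thesis
    by simp
qed

lemma drift_matrix_nth:
  "drift_matrix trib K H $ Inl e $ Inl e' = K $ e * (if e' = e then - 1 else if e' \<in> trib e then 1 else 0)"
  "drift_matrix trib K H $ Inl e $ Inr e' = (if e = e' then K $ e else 0)"
  "drift_matrix trib K H $ Inr e $ Inl e' = 0"
  "drift_matrix trib K H $ Inr e $ Inr e' = (if e = e' then - H $ e else 0)"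
  unfolding drift_matrix_def block_matrix_def
  by (simp_all add: diag_matrix_mult_nth) (simp_all add: diag_matrix_def incidence_matrix_def)

section \<open>Sign structure and stability of the drift matrix\<close>

lemma metzler_drift_matrix:
  assumes "\<And>e. 0 < K $ e"
  shows "metzler (drift_matrix trib K H)"
  unfolding metzler_def
proof (intro allI impI)
  show "0 \<le> drift_matrix trib K H $ i $ j" if "i \<noteq> j" for i j
    using that assms by (cases i; cases j) (auto simp: drift_matrix_nth less_imp_le)
qed

text \<open>The depth is the length of a shortest path from the root. Such a path to
  \<open>e'\<close> must end with the step from the unique parent \<open>e\<close>, so removing that
  step gives a shorter path to \<open>e\<close>.\<close>

lemma tree_depth:
  assumes "rooted_binary_tree r trib"
  obtains d :: "'e::finite \<Rightarrow> nat" where "\<And>e e'. e' \<in> trib e \<Longrightarrow> d e < d e'"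
proof
  let ?R = "{(e1, e2). e2 \<in> trib e1}"
  define d where "d e = (LEAST n. (r, e) \<in> ?R ^^ n)" for e
  show "d e < d e'" if "e' \<in> trib e" for e e'
  proof -
    have "e' \<noteq> r"
      using assms that unfolding rooted_binary_tree_def by auto
    then have unique: "p = e" if "e' \<in> trib p" for p
      using assms that \<open>e' \<in> trib e\<close> unfolding rooted_binary_tree_def by metis
    have "(r, e') \<in> ?R\<^sup>*"
      using assms unfolding rooted_binary_tree_def by simp
    then obtain n where "(r, e') \<in> ?R ^^ n"
      unfolding rtrancl_is_UN_relpow by blast
    then have "(r, e') \<in> ?R ^^ d e'"
      unfolding d_def by (rule LeastI)
    moreover from this \<open>e' \<noteq> r\<close> obtain m where m: "d e' = Suc m"
      by (cases "d e'") auto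
    ultimately have "(r, e') \<in> ?R ^^ m O ?R"
      by simp
    then have "(r, e) \<in> ?R ^^ m"
      using unique by blast
    then have "d e \<le> m"
      unfolding d_def by (rule Least_le)
    then show ?thesis
      using m by simp
  qed
qed

text \<open>
  A link has at most two tributaries, so weights \<open>4\<^sup>-\<^sup>d\<close> at depth \<open>d\<close> make every row of the drift
  matrix strictly dominated by its diagonal entry.
\<close>

lemma drift_matrix_lyapunov:
  assumes tree: "rooted_binary_tree r trib"
    and K: "\<And>e. 0 < K $ e" and H: "\<And>e. 0 < H $ e"
  obtains c w where "0 < c" "\<And>i. 0 < w $ i" "\<And>i. (drift_matrix trib K H *v w) $ i \<le> - c * w $ i"
proof -
  obtain d :: "'a \<Rightarrow> nat" where d: "\<And>e e'. e' \<in> trib e \<Longrightarrow> d e < d e'"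
    using tree_depth[OF tree] by blast
  define \<rho> where "\<rho> e = (1 / 4 :: real) ^ d e" for e
  \<comment> \<open>In units of \<open>K $ e * \<rho> e\<close>, a row of \<open>Q\<close> receives
    at most 1/2 from the tributaries and 1/4 from the \<open>R\<close> entry, against -1 on the
    diagonal. The remaining margin of 1/4 is the origin of \<open>K $ e / 4\<close> in
    \<open>c\<close>.\<close>
  define w where "w = block_vector (\<chi> e. \<rho> e) (\<chi> e. \<rho> e / 4)"
  have w: "w $ Inl e = \<rho> e" "w $ Inr e = \<rho> e / 4" for e
    by (simp_all add: w_def block_vector_def)
  have \<rho>_pos: "0 < \<rho> e" for e
    by (simp add: \<rho>_def)
  define c where "c = Min (range (\<lambda>e. min (K $ e / 4) (H $ e)))"
  have c: "c \<le> K $ e / 4" "c \<le> H $ e" for e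
  proof -
    have "c \<le> min (K $ e / 4) (H $ e)"
      unfolding c_def by (intro Min_le) auto
    then show "c \<le> K $ e / 4" "c \<le> H $ e"
      by auto
  qed
  have "0 < c"
    unfolding c_def using K H by (subst Min_gr_iff) auto
  moreover have "0 < w $ i" for i
    by (cases i) (simp_all add: w \<rho>_pos)
  moreover have "(drift_matrix trib K H *v w) $ i \<le> - c * w $ i" for i
  proof (cases i)
    case (Inl e)
    have card: "card (trib e) \<le> 2"
      using tree unfolding rooted_binary_tree_def by (metis card.empty le0 order_refl)
    have "(\<Sum>e'\<in>trib e. \<rho> e') \<le> real (card (trib e)) * (\<rho> e / 4)"
    proof (rule sum_bounded_above)
      fix e' assume "e' \<in> trib e"
      then have "Suc (d e) \<le> d e'"
        using d by (simp add: Suc_le_eq)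
      then have "\<rho> e' \<le> (1 / 4) ^ Suc (d e)"
        unfolding \<rho>_def by (intro power_decreasing) auto
      then show "\<rho> e' \<le> \<rho> e / 4"
        by (simp add: \<rho>_def)
    qed
    also have "\<dots> \<le> 2 * (\<rho> e / 4)"
      using card \<rho>_pos[of e] by (intro mult_right_mono) auto
    finally have trib_sum: "(\<Sum>e'\<in>trib e. \<rho> e') \<le> \<rho> e / 2"
      by simp
    have "e \<notin> trib e"
      using d by blast
    then have "(\<Sum>e'\<in>UNIV. drift_matrix trib K H $ Inl e $ Inl e' * w $ Inl e') =
        K $ e * ((\<Sum>e'\<in>UNIV. if e' \<in> trib e then \<rho> e' else 0) - (\<Sum>e'\<in>UNIV. if e' = e then \<rho> e' else 0))"
      unfolding sum_subtractf[symmetric] sum_distrib_left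
      by (intro sum.cong refl) (auto simp: drift_matrix_nth w)
    also have "\<dots> = K $ e * ((\<Sum>e'\<in>trib e. \<rho> e') - \<rho> e)"
      by (simp flip: sum.inter_filter)
    finally have links: "(\<Sum>e'\<in>UNIV. drift_matrix trib K H $ Inl e $ Inl e' * w $ Inl e') =
        K $ e * ((\<Sum>e'\<in>trib e. \<rho> e') - \<rho> e)" .
    have "(\<Sum>e'\<in>UNIV. drift_matrix trib K H $ Inl e $ Inr e' * w $ Inr e') =
        (\<Sum>e'\<in>UNIV. if e = e' then K $ e * (\<rho> e' / 4) else 0)"
      by (intro sum.cong) (auto simp: drift_matrix_nth w)
    also have "\<dots> = K $ e * (\<rho> e / 4)"
      by simp
    finally have "(drift_matrix trib K H *v w) $ Inl e =
        K $ e * ((\<Sum>e'\<in>trib e. \<rho> e') - \<rho> e + \<rho> e / 4)"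
      unfolding matrix_vector_mult_nth sum_UNIV_plus links by (simp only: distrib_left)
    also have "\<dots> \<le> K $ e * (- (\<rho> e / 4))"
      using trib_sum K[of e] by (intro mult_left_mono) (auto simp: field_simps)
    also have "\<dots> \<le> - c * \<rho> e"
      using mult_right_mono[OF c(1)[of e] less_imp_le[OF \<rho>_pos[of e]]] by simp
    finally show ?thesis
      by (simp add: Inl w)
  next
    case (Inr e)
    have "(\<Sum>e'\<in>UNIV. drift_matrix trib K H $ Inr e $ Inr e' * w $ Inr e') =
        (\<Sum>e'\<in>UNIV. if e = e' then - H $ e * (\<rho> e' / 4) else 0)"
      by (intro sum.cong) (auto simp: drift_matrix_nth w)
    then have "(drift_matrix trib K H *v w) $ Inr e = - H $ e * (\<rho> e / 4)"
      unfolding matrix_vector_mult_nth sum_UNIV_plus by (simp add: drift_matrix_nth)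
    also have "\<dots> \<le> - c * (\<rho> e / 4)"
      using c(2)[of e] \<rho>_pos[of e] by (intro mult_right_mono) auto
    finally show ?thesis
      by (simp add: Inr w)
  qed
  ultimately show ?thesis
    using that by blast
qed

lemma drift_matrix_exp_decay:
  assumes "rooted_binary_tree r trib" "\<And>e. 0 < K $ e" "\<And>e. 0 < H $ e"
  obtains c C where "0 < c" "0 < C"
    "\<And>s i j. 0 \<le> s \<Longrightarrow> matrix_exp (s *\<^sub>R drift_matrix trib K H) $ i $ j \<le> C * exp (- c * s)"
proof -
  obtain c w where c: "0 < c" and w: "\<And>i. 0 < w $ i"
      "\<And>i. (drift_matrix trib K H *v w) $ i \<le> - c * w $ i"
    by (rule drift_matrix_lyapunov[OF assms]) (rule that)
  \<comment> \<open>There are finitely many weights, so one constant dominates all ratios; their sum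
    is a convenient choice.\<close>
  define C where "C = (\<Sum>i\<in>UNIV. \<Sum>j\<in>UNIV. w $ i / w $ j)"
  have C: "w $ i / w $ j \<le> C" for i j
  proof -
    have "w $ i / w $ j \<le> (\<Sum>j\<in>UNIV. w $ i / w $ j)"
      by (intro member_le_sum divide_nonneg_nonneg less_imp_le[OF w(1)]) auto
    also have "\<dots> \<le> C"
      unfolding C_def
      by (intro member_le_sum[where f="\<lambda>i. \<Sum>j\<in>UNIV. w $ i / w $ j"] sum_nonneg
          divide_nonneg_nonneg less_imp_le[OF w(1)]) auto
    finally show ?thesis .
  qed
  show thesis
  proof
    show "0 < c"
      by fact
    show "0 < C"
      using C[of undefined undefined] w(1)[of undefined] by simp
    show "matrix_exp (s *\<^sub>R drift_matrix trib K H) $ i $ j \<le> C * exp (- c * s)" if "0 \<le> s" for s i j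
      using matrix_exp_decay[OF metzler_drift_matrix[OF assms(2)] that w, of i j]
        mult_left_mono[OF C[of i j], of "exp (- c * s)"] by (simp add: mult.commute)
  qed
qed

text \<open>Beyond some \<open>T\<close> the exponential bound lies below the positive value
  \<open>f s0\<close>, so a maximum over the compact interval up to \<open>max T s0\<close> is
  global; the interval must contain \<open>s0\<close> for this comparison.\<close>

lemma sup_attained_of_decay:
  fixes f :: "real \<Rightarrow> real"
  assumes cont: "continuous_on {0..} f" and "0 < c"
    and le: "\<And>s. 0 \<le> s \<Longrightarrow> f s \<le> C * exp (- c * s)"
    and s0: "0 \<le> s0" "0 < f s0"
  obtains s where "0 \<le> s" "\<And>t. 0 \<le> t \<Longrightarrow> f t \<le> f s"
proof -
  have "((\<lambda>t. C * exp (- c * t)) \<longlongrightarrow> C * 0) at_top"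
    using \<open>0 < c\<close> by (intro tendsto_mult tendsto_const filterlim_compose[OF exp_at_bot]
        filterlim_tendsto_neg_mult_at_bot[OF tendsto_const _ filterlim_ident]) simp
  then have "eventually (\<lambda>t. C * exp (- c * t) < f s0) at_top"
    using s0(2) by (intro order_tendstoD) auto
  then obtain T where T: "\<And>t. T \<le> t \<Longrightarrow> C * exp (- c * t) < f s0"
    by (auto simp: eventually_at_top_linorder)
  let ?I = "{0..max T s0}"
  have "continuous_on ?I f"
    by (rule continuous_on_subset[OF cont]) auto
  moreover have "?I \<noteq> {}"
    using s0(1) by auto
  ultimately obtain s where s: "s \<in> ?I" "\<And>t. t \<in> ?I \<Longrightarrow> f t \<le> f s"
    using continuous_attains_sup[OF compact_Icc] by metis
  show thesis
  proof
    show "0 \<le> s"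
      using s(1) by simp
    show "f t \<le> f s" if "0 \<le> t" for t
    proof (cases "t \<le> max T s0")
      case False
      then have "f t < f s0"
        using le[OF that] T[of t] by linarith
      then show ?thesis
        using s(2)[of s0] s0(1) by simp
    qed (use s(2) that in simp)
  qed
qed

section \<open>The response function and its maximum\<close>

definition root_response ::
    "('e::finite \<Rightarrow> 'e set) \<Rightarrow> real^'e \<Rightarrow> real^'e \<Rightarrow> real^'e \<Rightarrow> 'e \<Rightarrow> real \<Rightarrow> real" where
  "root_response trib K H a r s =
     (matrix_exp (s *\<^sub>R drift_matrix trib K H) *v block_vector 0 (diag_matrix H *v a)) $ Inl r"

lemma root_response_eq_sum:
  "root_response trib K H a r s =
    (\<Sum>e\<in>UNIV. H $ e * a $ e * matrix_exp (s *\<^sub>R drift_matrix trib K H) $ Inl r $ Inr e)"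
proof -
  have "(diag_matrix H *v a) $ e = H $ e * a $ e" for e
  proof -
    have "(diag_matrix H *v a) $ e = (\<Sum>e'\<in>UNIV. if e = e' then H $ e * a $ e' else 0)"
      unfolding matrix_vector_mult_nth diag_matrix_def vec_lambda_beta by (intro sum.cong) auto
    then show ?thesis
      by simp
  qed
  then show ?thesis
    unfolding root_response_def matrix_vector_mult_nth sum_UNIV_plus block_vector_def
    by (simp add: mult.commute)
qed

text \<open>The point \<open>u = 0\<close> corresponds to infinite age, where the response has died
  out; every other \<open>u\<close> corresponds to the age \<open>- ln u / H $ r\<close>.\<close>

lemma sum_response_vector:
  "(\<Sum>e\<in>UNIV. H $ e * a $ e * response_vector trib K H r u $ e) =
    (if u = 0 then 0 else root_response trib K H a r (- ln u / H $ r))"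
  by (simp add: response_vector_def root_response_eq_sum matrix_exp_transpose
      del: scaleR_minus_left)

lemma continuous_on_root_response: "continuous_on S (root_response trib K H a r)"
  unfolding root_response_eq_sum[abs_def]
  by (intro continuous_at_imp_continuous_on ballI continuous_intros isCont_matrix_exp_nth)

lemma root_response_nonneg:
  assumes "\<And>e. 0 < K $ e" "\<And>e. 0 < H $ e" "\<And>e. 0 < a $ e" "0 \<le> s"
  shows "0 \<le> root_response trib K H a r s"
  unfolding root_response_eq_sum
  by (intro sum_nonneg mult_nonneg_nonneg matrix_exp_nonneg metzler_drift_matrix assms(1,4)
      less_imp_le[OF assms(2)] less_imp_le[OF assms(3)])

text \<open>The summand of the root link alone is positive, through the direct coupling
  \<open>K $ r\<close> from \<open>R\<close> to \<open>Q\<close>; the others are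
  nonnegative.\<close>

lemma root_response_pos:
  assumes K: "\<And>e. 0 < K $ e" and H: "\<And>e. 0 < H $ e" and a: "\<And>e. 0 < a $ e" and s: "0 < s"
  shows "0 < root_response trib K H a r s"
  unfolding root_response_eq_sum
proof (rule sum_pos2)
  have metzler: "metzler (drift_matrix trib K H)"
    using K by (rule metzler_drift_matrix)
  show "0 < H $ r * a $ r * matrix_exp (s *\<^sub>R drift_matrix trib K H) $ Inl r $ Inr r"
    by (intro mult_pos_pos H a matrix_exp_pos metzler s) (simp_all add: drift_matrix_nth K)
  show "0 \<le> H $ e * a $ e * matrix_exp (s *\<^sub>R drift_matrix trib K H) $ Inl r $ Inr e" for e
    using H[of e] a[of e] s by (intro mult_nonneg_nonneg matrix_exp_nonneg metzler) auto
qed auto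

lemma root_response_decay:
  assumes "rooted_binary_tree r trib" "\<And>e. 0 < K $ e" "\<And>e. 0 < H $ e" "\<And>e. 0 < a $ e"
  obtains c C where "0 < c" "0 < C" "\<And>s. 0 \<le> s \<Longrightarrow> root_response trib K H a r s \<le> C * exp (- c * s)"
proof -
  obtain c C where c: "0 < c" "0 < C"
    "\<And>s i j. 0 \<le> s \<Longrightarrow> matrix_exp (s *\<^sub>R drift_matrix trib K H) $ i $ j \<le> C * exp (- c * s)"
    by (rule drift_matrix_exp_decay[OF assms(1-3)]) (rule that)
  show thesis
  proof
    show "0 < c"
      by fact
    show "0 < (\<Sum>e\<in>UNIV. H $ e * a $ e) * C"
      using assms c by (intro mult_pos_pos sum_pos) auto
    show "root_response trib K H a r s \<le> (\<Sum>e\<in>UNIV. H $ e * a $ e) * C * exp (- c * s)"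
      if "0 \<le> s" for s
      unfolding root_response_eq_sum sum_distrib_right mult.assoc[of _ C]
      by (intro sum_mono mult_left_mono c(3) that mult_nonneg_nonneg less_imp_le[OF assms(3)]
          less_imp_le[OF assms(4)])
  qed
qed

text \<open>\<open>GREATEST\<close> is evaluated by exhibiting a maximiser. Positivity of the
  maximum settles the comparison with the value 0 at \<open>u = 0\<close>.\<close>

lemma max_response_attained:
  assumes tree: "rooted_binary_tree r trib" and K: "\<And>e. 0 < K $ e" and H: "\<And>e. 0 < H $ e"
    and a: "\<And>e. 0 < a $ e"
  shows "\<exists>s\<ge>0. root_response trib K H a r s = max_response trib K H a r"
    and "0 \<le> t \<Longrightarrow> root_response trib K H a r t \<le> max_response trib K H a r"
    and "0 < max_response trib K H a r"
proof -
  let ?f = "root_response trib K H a r"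
  obtain c C where "0 < c" "0 < C" "\<And>s. 0 \<le> s \<Longrightarrow> ?f s \<le> C * exp (- c * s)"
    by (rule root_response_decay[OF tree K H a]) (rule that)
  \<comment> \<open>Any positive age would do, but not age 0: a storm enters through
    \<open>R\<close>, so the response in \<open>Q\<close> starts from 0.\<close>
  moreover have f1: "0 < ?f 1"
    using root_response_pos[of K H a 1 trib r] K H a by simp
  ultimately obtain s where s: "0 \<le> s" "\<And>t. 0 \<le> t \<Longrightarrow> ?f t \<le> ?f s"
    using sup_attained_of_decay[of ?f c C 1, OF continuous_on_root_response] by auto
  have pos: "0 < ?f s"
    using s(2)[of 1] f1 by simp
  have "max_response trib K H a r = ?f s"
    unfolding max_response_def sum_response_vector
  proof (rule Greatest_equality)
    show "?f s \<in> (\<lambda>u. if u = 0 then 0 else ?f (- ln u / H $ r)) ` {0..1}"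
      using H[of r] s(1) by (intro image_eqI[of _ _ "exp (- (H $ r * s))"]) auto
    show "y \<le> ?f s" if "y \<in> (\<lambda>u. if u = 0 then 0 else ?f (- ln u / H $ r)) ` {0..1}" for y
    proof -
      obtain u where u: "u \<in> {0..1}" and y: "y = (if u = 0 then 0 else ?f (- ln u / H $ r))"
        using \<open>y \<in> _\<close> by blast
      show ?thesis
      proof (cases "u = 0")
        case False
        then have "0 \<le> - ln u / H $ r"
          using u H[of r] by (intro divide_nonneg_pos) auto
        then show ?thesis
          using s(2) y False by simp
      qed (use y pos in simp)
    qed
  qed
  then show "\<exists>s\<ge>0. ?f s = max_response trib K H a r"
      "0 \<le> t \<Longrightarrow> ?f t \<le> max_response trib K H a r" "0 < max_response trib K H a r"
    using s pos by auto
qed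

section \<open>Poisson processes and exponential depths\<close>

text \<open>With \<open>\<nu> j\<close> the number of storms up to time j, the block
  \<open>{\<nu> j<..\<nu> (Suc j)}\<close> numbers the storms after time j and up to j + 1, so sums
  over storms split by unit intervals.\<close>

lemma sum_blocks:
  fixes \<nu> :: "nat \<Rightarrow> nat" and h :: "nat \<Rightarrow> 'a::comm_monoid_add"
  assumes "mono \<nu>"
  shows "(\<Sum>j<m. \<Sum>n\<in>{\<nu> j<..\<nu> (Suc j)}. h n) = (\<Sum>n\<in>{\<nu> 0<..\<nu> m}. h n)"
proof (induction m)
  case (Suc m)
  have "{\<nu> 0<..\<nu> (Suc m)} = {\<nu> 0<..\<nu> m} \<union> {\<nu> m<..\<nu> (Suc m)}"
    using monoD[OF assms, of 0 m] monoD[OF assms, of m "Suc m"] by auto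
  then show ?case
    by (simp add: Suc sum.union_disjoint)
qed simp

lemma prod_blocks:
  fixes \<nu> :: "nat \<Rightarrow> nat" and h :: "nat \<Rightarrow> 'a::comm_monoid_mult"
  assumes "mono \<nu>"
  shows "(\<Prod>j<m. \<Prod>n\<in>{\<nu> j<..\<nu> (Suc j)}. h n) = (\<Prod>n\<in>{\<nu> 0<..\<nu> m}. h n)"
proof (induction m)
  case (Suc m)
  have "{\<nu> 0<..\<nu> (Suc m)} = {\<nu> 0<..\<nu> m} \<union> {\<nu> m<..\<nu> (Suc m)}"
    using monoD[OF assms, of 0 m] monoD[OF assms, of m "Suc m"] by auto
  then show ?case
    by (simp add: Suc prod.union_disjoint)
qed simp

text \<open>This recovers the unit interval from the number of the storm, so that a weight per
  interval can be written as a weight per storm.\<close>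

lemma block_index:
  fixes \<nu> :: "nat \<Rightarrow> nat"
  assumes "mono \<nu>" "n \<in> {\<nu> j<..\<nu> (Suc j)}"
  shows "(LEAST i. n \<le> \<nu> (Suc i)) = j"
proof (rule Least_equality)
  show "n \<le> \<nu> (Suc j)"
    using assms(2) by simp
  show "j \<le> i" if "n \<le> \<nu> (Suc i)" for i
    using that assms(2) monoD[OF assms(1), of "Suc i" j] by (cases "j \<le> i") auto
qed

lemma poisson_pmf_pgf:
  fixes \<mu> z :: real
  assumes "0 < \<mu>" "0 \<le> z"
  shows "(\<integral>\<^sup>+k. ennreal (z ^ k) \<partial>poisson_pmf \<mu>) = ennreal (exp (\<mu> * (z - 1)))"
proof -
  have "(\<lambda>k. (\<mu> * z) ^ k /\<^sub>R fact k * exp (- \<mu>)) sums (exp (\<mu> * z) * exp (- \<mu>))"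
    by (intro sums_mult2 exp_converges)
  then have sums: "(\<lambda>k. \<mu> ^ k / fact k * exp (- \<mu>) * z ^ k) sums exp (\<mu> * (z - 1))"
    by (simp add: power_mult_distrib divide_inverse mult_ac right_diff_distrib flip: exp_add)
  have "(\<integral>\<^sup>+k. ennreal (z ^ k) \<partial>poisson_pmf \<mu>) =
      (\<integral>\<^sup>+k. ennreal (\<mu> ^ k / fact k * exp (- \<mu>) * z ^ k) \<partial>count_space UNIV)"
    using assms by (simp add: nn_integral_measure_pmf flip: ennreal_mult)
  also have "\<dots> = (\<Sum>k. ennreal (\<mu> ^ k / fact k * exp (- \<mu>) * z ^ k))"
    by (rule nn_integral_count_space_nat)
  also have "\<dots> = ennreal (exp (\<mu> * (z - 1)))"
    using assms by (intro suminf_ennreal_eq sums) simp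
  finally show ?thesis .
qed

text \<open>Exponential tilting: multiplied by \<open>exp (c * x)\<close>, the density becomes
  \<open>\<sigma> / (\<sigma> - c)\<close> times the exponential density of rate
  \<open>\<sigma> - c\<close>.\<close>

lemma (in prob_space) exponential_distributed_mgf:
  assumes D: "distributed M lborel X (exponential_density \<sigma>)" and s: "0 < \<sigma>" "c < \<sigma>"
  shows "(\<integral>\<^sup>+\<omega>. ennreal (exp (c * X \<omega>)) \<partial>M) = ennreal (\<sigma> / (\<sigma> - c))"
proof -
  interpret E: prob_space "density lborel (exponential_density (\<sigma> - c))"
    using s by (intro prob_space_exponential_density) simp
  have "(\<integral>\<^sup>+\<omega>. ennreal (exp (c * X \<omega>)) \<partial>M) =
      (\<integral>\<^sup>+x. ennreal (exponential_density \<sigma> x) * ennreal (exp (c * x)) \<partial>lborel)"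
    by (rule distributed_nn_integral[OF D, symmetric]) simp
  also have "\<dots> = (\<integral>\<^sup>+x. ennreal (\<sigma> / (\<sigma> - c)) * ennreal (exponential_density (\<sigma> - c) x) \<partial>lborel)"
  proof (rule nn_integral_cong)
    fix x :: real
    have "exp (- x * \<sigma>) * exp (c * x) = exp (- x * (\<sigma> - c))"
      by (simp add: algebra_simps flip: exp_add)
    then have "exponential_density \<sigma> x * exp (c * x) = \<sigma> / (\<sigma> - c) * exponential_density (\<sigma> - c) x"
      using s by (simp add: exponential_density_def field_simps)
    then show "ennreal (exponential_density \<sigma> x) * ennreal (exp (c * x)) =
        ennreal (\<sigma> / (\<sigma> - c)) * ennreal (exponential_density (\<sigma> - c) x)"
      using s by (simp add: exponential_density_def flip: ennreal_mult)
  qed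
  also have "\<dots> = ennreal (\<sigma> / (\<sigma> - c)) * emeasure (density lborel (exponential_density (\<sigma> - c))) UNIV"
    by (simp add: nn_integral_cmult emeasure_density)
  also have "emeasure (density lborel (exponential_density (\<sigma> - c))) UNIV = 1"
    using E.emeasure_space_1 by simp
  finally show ?thesis
    by simp
qed

text \<open>Tonelli's theorem for the product of the two laws; the second variable is evaluated at
  an independent copy of the sample point. It serves to integrate out the depths with the counts
  frozen.\<close>

lemma (in prob_space) nn_integral_indep_var:
  assumes ind: "indep_var S X T Y" and f: "f \<in> borel_measurable (S \<Otimes>\<^sub>M T)"
  shows "(\<integral>\<^sup>+\<omega>. f (X \<omega>, Y \<omega>) \<partial>M) = (\<integral>\<^sup>+\<omega>. \<integral>\<^sup>+\<omega>'. f (X \<omega>, Y \<omega>') \<partial>M \<partial>M)"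
proof -
  have X: "X \<in> measurable M S" and Y: "Y \<in> measurable M T"
    and eq: "distr M S X \<Otimes>\<^sub>M distr M T Y = distr M (S \<Otimes>\<^sub>M T) (\<lambda>\<omega>. (X \<omega>, Y \<omega>))"
    using ind by (simp_all add: indep_var_distribution_eq)
  interpret Y: prob_space "distr M T Y"
    by (rule prob_space_distr) fact
  note [measurable] = X Y f
  have "(\<integral>\<^sup>+\<omega>. f (X \<omega>, Y \<omega>) \<partial>M) = (\<integral>\<^sup>+z. f z \<partial>distr M (S \<Otimes>\<^sub>M T) (\<lambda>\<omega>. (X \<omega>, Y \<omega>)))"
    by (subst nn_integral_distr) simp_all
  also have "\<dots> = (\<integral>\<^sup>+x. \<integral>\<^sup>+y. f (x, y) \<partial>distr M T Y \<partial>distr M S X)"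
    unfolding eq[symmetric] by (subst Y.nn_integral_fst) simp_all
  also have "\<dots> = (\<integral>\<^sup>+\<omega>. \<integral>\<^sup>+y. f (X \<omega>, y) \<partial>distr M T Y \<partial>M)"
    by (subst nn_integral_distr) simp_all
  also have "\<dots> = (\<integral>\<^sup>+\<omega>. \<integral>\<^sup>+\<omega>'. f (X \<omega>, Y \<omega>') \<partial>M \<partial>M)"
    by (intro nn_integral_cong, subst nn_integral_distr) simp_all
  finally show ?thesis .
qed

section \<open>Jump times, depths and their joint exponential moments\<close>

locale poisson_rainfall = prob_space M for M :: "'w measure" +
  fixes rate \<sigma> :: real and N :: "real \<Rightarrow> 'w \<Rightarrow> nat" and P :: "nat \<Rightarrow> 'w \<Rightarrow> real"
  assumes rate_pos: "0 < rate" and \<sigma>_pos: "0 < \<sigma>"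
    and poisson: "poisson_process rate N" and rainfall: "rainfall_depths N P"
    and exponential: "distributed M lborel (P 1) (exponential_density \<sigma>)"
begin

lemma N_measurable [measurable]: "0 \<le> t \<Longrightarrow> N t \<in> measurable M (count_space UNIV)"
  using poisson unfolding poisson_process_def by blast

lemma N_0: "\<omega> \<in> space M \<Longrightarrow> N 0 \<omega> = 0"
  using poisson unfolding poisson_process_def by blast

lemma N_mono: "\<omega> \<in> space M \<Longrightarrow> 0 \<le> s \<Longrightarrow> s \<le> t \<Longrightarrow> N s \<omega> \<le> N t \<omega>"
  using poisson mono_onD[of "{0..}" "\<lambda>t. N t \<omega>" s t] unfolding poisson_process_def by simp

lemma N_mono_nat: "\<omega> \<in> space M \<Longrightarrow> mono (\<lambda>j. N (real j) \<omega>)"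
  by (intro monoI N_mono) auto

text \<open>The values are natural numbers, so convergence from the right means being eventually
  constant.\<close>

lemma N_right_continuous:
  assumes "\<omega> \<in> space M" "0 \<le> s"
  obtains \<delta> where "0 < \<delta>" "\<And>u. s < u \<Longrightarrow> u < s + \<delta> \<Longrightarrow> N u \<omega> = N s \<omega>"
proof -
  have "((\<lambda>s. N s \<omega>) \<longlongrightarrow> N s \<omega>) (at_right s)"
    using poisson assms unfolding poisson_process_def by blast
  then have "eventually (\<lambda>u. N u \<omega> = N s \<omega>) (at_right s)"
    by (simp add: tendsto_discrete)
  then obtain b where b: "s < b" "\<And>u. s < u \<Longrightarrow> u < b \<Longrightarrow> N u \<omega> = N s \<omega>"
    by (auto simp: eventually_at_right_field)
  show thesis
    by (rule that[of "b - s"]) (use b in auto)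
qed

lemma N_positive_prob:
  assumes "0 < t"
  shows "0 < prob {\<omega> \<in> space M. 1 \<le> N t \<omega>}"
proof -
  have "distr M (count_space UNIV) (\<lambda>\<omega>. N t \<omega> - N 0 \<omega>) = measure_pmf (poisson_pmf (rate * (t - 0)))"
    using poisson assms unfolding poisson_process_def by blast
  moreover have "distr M (count_space UNIV) (\<lambda>\<omega>. N t \<omega> - N 0 \<omega>) = distr M (count_space UNIV) (N t)"
    by (intro distr_cong) (auto simp: N_0)
  ultimately have "prob {\<omega> \<in> space M. 1 \<le> N t \<omega>} = measure (poisson_pmf (rate * t)) {1..}"
    using assms measure_distr[of "N t" M "count_space UNIV" "{1..}"]
    by (simp add: vimage_def Int_def conj_commute)
  also have "\<dots> \<ge> measure (poisson_pmf (rate * t)) {1}"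
    by (intro measure_pmf.finite_measure_mono) auto
  also have "measure (poisson_pmf (rate * t)) {1} = rate * t * exp (- (rate * t))"
    using rate_pos assms by (simp add: measure_pmf_single)
  finally show ?thesis
    using mult_pos_pos[OF mult_pos_pos[OF rate_pos assms] exp_gt_zero] less_le_trans by blast
qed

lemma jump_time_nonneg:
  assumes "0 \<le> t" "n \<le> N t \<omega>"
  shows "0 \<le> jump_time N n \<omega>"
  unfolding jump_time_def using assms by (intro cInf_greatest) auto

text \<open>The bound at \<open>t\<close> makes the set under the infimum nonempty. Right continuity
  makes the infimum attained: if level \<open>n\<close> is not reached at \<open>s\<close>, it is
  not reached before \<open>s + \<delta>\<close> either.\<close>

lemma jump_time_le_iff:
  assumes \<omega>: "\<omega> \<in> space M" and t: "0 \<le> t" "n \<le> N t \<omega>" and s: "0 \<le> s"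
  shows "jump_time N n \<omega> \<le> s \<longleftrightarrow> n \<le> N s \<omega>"
proof
  show "jump_time N n \<omega> \<le> s" if "n \<le> N s \<omega>"
    unfolding jump_time_def using that s by (intro cInf_lower bdd_belowI[of _ 0]) auto
  show "n \<le> N s \<omega>" if le: "jump_time N n \<omega> \<le> s"
  proof (rule ccontr)
    assume neg: "\<not> n \<le> N s \<omega>"
    obtain \<delta> where \<delta>: "0 < \<delta>" "\<And>u. s < u \<Longrightarrow> u < s + \<delta> \<Longrightarrow> N u \<omega> = N s \<omega>"
      using N_right_continuous[OF \<omega> s] by blast
    have "s + \<delta> \<le> jump_time N n \<omega>"
      unfolding jump_time_def
    proof (rule cInf_greatest)
      show "{t. 0 \<le> t \<and> n \<le> N t \<omega>} \<noteq> {}"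
        using t by blast
      fix u assume u: "u \<in> {t. 0 \<le> t \<and> n \<le> N t \<omega>}"
      then have "s < u"
        using neg N_mono[OF \<omega>, of u s] by fastforce
      then show "s + \<delta> \<le> u"
        using \<delta>(2)[of u] u neg by fastforce
    qed
    then show False
      using le \<delta>(1) by simp
  qed
qed

text \<open>The default 0 replaces the infimum when storm \<open>n\<close> has not occurred by time
  \<open>t\<close>; sublevel sets then become events about the counts at two fixed times.\<close>

lemma jump_time_measurable:
  assumes t: "0 \<le> t"
  shows "(\<lambda>\<omega>. if n \<le> N t \<omega> then jump_time N n \<omega> else 0) \<in> borel_measurable M"
  unfolding borel_measurable_iff_le
proof
  note [measurable] = N_measurable[OF t]
  fix c :: real
  let ?U = "\<lambda>\<omega>. if n \<le> N t \<omega> then jump_time N n \<omega> else 0"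
  show "{\<omega> \<in> space M. ?U \<omega> \<le> c} \<in> sets M"
  proof (cases "0 \<le> c")
    case True
    note [measurable] = N_measurable[OF True]
    have "{\<omega> \<in> space M. ?U \<omega> \<le> c} = {\<omega> \<in> space M. n \<le> N t \<omega> \<longrightarrow> n \<le> N c \<omega>}"
      using jump_time_le_iff[OF _ t _ True] True by auto
    then show ?thesis
      by simp
  next
    case False
    have "0 \<le> ?U \<omega>" for \<omega>
      using jump_time_nonneg[OF t] by simp
    with False have "{\<omega> \<in> space M. ?U \<omega> \<le> c} = {}"
      using order_trans by blast
    then show ?thesis
      by (simp only: sets.empty_sets)
  qed
qed

lemma P_measurable [measurable]: "1 \<le> n \<Longrightarrow> P n \<in> borel_measurable M"
  using rainfall unfolding rainfall_depths_def indep_vars_def by auto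

lemma P_pos: "AE \<omega> in M. \<forall>n\<ge>1. 0 < P n \<omega>"
  using rainfall unfolding rainfall_depths_def AE_all_countable by auto

text \<open>
  Both arguments of \<^const>\<open>indep_var\<close> have the same type, so in \<open>rainfall_depths\<close> the counting
  process is coerced to a function \<^typ>\<open>nat \<Rightarrow> real\<close>: only its values at integer times are assumed
  to be independent of the depths.  Hence the unit blocks and the grid of observation times below.
\<close>

lemma indep_N_P:
  "indep_var (PiM UNIV (\<lambda>_. count_space UNIV)) (\<lambda>\<omega> j. real (N (real j) \<omega>))
     (PiM {1..} (\<lambda>_. borel)) (\<lambda>\<omega>. \<lambda>n\<in>{1..}. P n \<omega>)"
  using rainfall unfolding rainfall_depths_def by simp

lemma P_mgf:
  assumes "1 \<le> n" "c < \<sigma>"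
  shows "(\<integral>\<^sup>+\<omega>. ennreal (exp (c * P n \<omega>)) \<partial>M) = ennreal (\<sigma> / (\<sigma> - c))"
proof -
  have "(\<integral>\<^sup>+\<omega>. ennreal (exp (c * P n \<omega>)) \<partial>M) = (\<integral>\<^sup>+x. ennreal (exp (c * x)) \<partial>distr M borel (P n))"
    using assms by (subst nn_integral_distr) auto
  also have "distr M borel (P n) = distr M borel (P 1)"
    using rainfall assms unfolding rainfall_depths_def by blast
  also have "(\<integral>\<^sup>+x. ennreal (exp (c * x)) \<partial>distr M borel (P 1)) = (\<integral>\<^sup>+\<omega>. ennreal (exp (c * P 1 \<omega>)) \<partial>M)"
    by (subst nn_integral_distr) auto
  also have "\<dots> = ennreal (\<sigma> / (\<sigma> - c))"
    by (rule exponential_distributed_mgf[OF exponential \<sigma>_pos assms(2)])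
  finally show ?thesis .
qed

lemma nn_integral_exp_weighted_depths:
  assumes "finite I" "I \<subseteq> {1..}" "\<And>n. n \<in> I \<Longrightarrow> c n < \<sigma>"
  shows "(\<integral>\<^sup>+\<omega>. ennreal (exp (\<Sum>n\<in>I. c n * P n \<omega>)) \<partial>M) = (\<Prod>n\<in>I. ennreal (\<sigma> / (\<sigma> - c n)))"
proof -
  have "indep_vars (\<lambda>_. borel) P I"
    using rainfall assms(2) unfolding rainfall_depths_def by (blast intro: indep_vars_subset)
  then have ind: "indep_vars (\<lambda>_. borel) (\<lambda>n \<omega>. ennreal (exp (c n * P n \<omega>))) I"
    by (rule indep_vars_compose2[where Y="\<lambda>n x. ennreal (exp (c n * x))"]) measurable
  have "(\<integral>\<^sup>+\<omega>. ennreal (exp (\<Sum>n\<in>I. c n * P n \<omega>)) \<partial>M) =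
      (\<integral>\<^sup>+\<omega>. (\<Prod>n\<in>I. ennreal (exp (c n * P n \<omega>))) \<partial>M)"
    using assms(1) by (simp add: exp_sum prod_ennreal)
  also have "\<dots> = (\<Prod>n\<in>I. \<integral>\<^sup>+\<omega>. ennreal (exp (c n * P n \<omega>)) \<partial>M)"
    by (rule indep_vars_nn_integral[OF assms(1) ind]) simp
  also have "\<dots> = (\<Prod>n\<in>I. ennreal (\<sigma> / (\<sigma> - c n)))"
    using assms by (intro prod.cong refl P_mgf) auto
  finally show ?thesis .
qed

text \<open>The increments over unit intervals are independent Poisson variables of mean
  \<open>rate\<close>, so the generating functions multiply. In the application \<open>z j\<close>
  is the exponential moment of one weighted depth.\<close>

lemma nn_integral_prod_increments:
  assumes "\<And>j. 0 \<le> z j"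
  shows "(\<integral>\<^sup>+\<omega>. (\<Prod>j<m. ennreal (z j ^ (N (real (Suc j)) \<omega> - N (real j) \<omega>))) \<partial>M) =
    ennreal (exp (rate * (\<Sum>j<m. z j - 1)))"
proof -
  have "\<forall>\<tau>::nat \<Rightarrow> real. 0 \<le> \<tau> 0 \<and> mono \<tau> \<longrightarrow>
      indep_vars (\<lambda>_. count_space UNIV) (\<lambda>i \<omega>. N (\<tau> (Suc i)) \<omega> - N (\<tau> i) \<omega>) UNIV"
    using poisson unfolding poisson_process_def by blast
  from this[rule_format, of real]
  have "indep_vars (\<lambda>_. count_space UNIV) (\<lambda>i \<omega>. N (real (Suc i)) \<omega> - N (real i) \<omega>) UNIV"
    by (simp add: mono_def)
  then have "indep_vars (\<lambda>_. count_space UNIV) (\<lambda>i \<omega>. N (real (Suc i)) \<omega> - N (real i) \<omega>) {..<m}"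
    by (rule indep_vars_subset) simp
  then have ind: "indep_vars (\<lambda>_. borel) (\<lambda>j \<omega>. ennreal (z j ^ (N (real (Suc j)) \<omega> - N (real j) \<omega>))) {..<m}"
    by (rule indep_vars_compose2[where Y="\<lambda>j k. ennreal (z j ^ k)"]) simp
  have "(\<integral>\<^sup>+\<omega>. ennreal (z j ^ (N (real (Suc j)) \<omega> - N (real j) \<omega>)) \<partial>M) = ennreal (exp (rate * (z j - 1)))"
    for j
  proof -
    have distr: "distr M (count_space UNIV) (\<lambda>\<omega>. N (real (Suc j)) \<omega> - N (real j) \<omega>) =
        measure_pmf (poisson_pmf (rate * (real (Suc j) - real j)))"
      using poisson unfolding poisson_process_def by auto
    note [measurable] = N_measurable[of "real j"] N_measurable[of "real (Suc j)"]
    have meas: "(\<lambda>\<omega>. N (real (Suc j)) \<omega> - N (real j) \<omega>) \<in> measurable M (count_space UNIV)"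
      by measurable
    have "(\<integral>\<^sup>+\<omega>. ennreal (z j ^ (N (real (Suc j)) \<omega> - N (real j) \<omega>)) \<partial>M) =
        (\<integral>\<^sup>+k. ennreal (z j ^ k) \<partial>poisson_pmf (rate * (real (Suc j) - real j)))"
      unfolding distr[symmetric] by (subst nn_integral_distr[OF meas]) simp_all
    also have "\<dots> = ennreal (exp (rate * (z j - 1)))"
      using poisson_pmf_pgf[OF rate_pos assms] by simp
    finally show ?thesis .
  qed
  then show ?thesis
    by (subst indep_vars_nn_integral[OF _ ind])
      (simp_all add: prod_ennreal sum_distrib_left flip: exp_sum)
qed

text \<open>
  Conditionally on \<open>N\<close> the depths are independent exponentials, so integrating them out leaves a
  product of powers of independent Poisson increments.
\<close>

lemma nn_integral_exp_block_depths:
  assumes G: "\<And>j. 0 \<le> G j" "\<And>j. G j < \<sigma>"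
  shows "(\<integral>\<^sup>+\<omega>. ennreal (exp (\<Sum>j<m. G j * (\<Sum>n\<in>{N (real j) \<omega><..N (real (Suc j)) \<omega>}. P n \<omega>))) \<partial>M) =
    ennreal (exp (rate * (\<Sum>j<m. G j / (\<sigma> - G j))))"
proof -
  let ?S = "PiM UNIV (\<lambda>_. count_space UNIV) :: (nat \<Rightarrow> real) measure"
  let ?T = "PiM {1..} (\<lambda>_. borel) :: (nat \<Rightarrow> real) measure"
  define X where "X \<omega> = (\<lambda>j. real (N (real j) \<omega>))" for \<omega>
  define Y where "Y \<omega> = (\<lambda>n\<in>{1..}. P n \<omega>)" for \<omega>
  \<comment> \<open>The counts arrive as real numbers; \<open>nat \<lfloor>\<nu> j\<rfloor>\<close>
    turns them back into summation bounds.\<close>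
  define \<Phi> where "\<Phi> = (\<lambda>(\<nu> :: nat \<Rightarrow> real, p).
    ennreal (exp (\<Sum>j<m. G j * (\<Sum>n\<in>{nat \<lfloor>\<nu> j\<rfloor><..nat \<lfloor>\<nu> (Suc j)\<rfloor>}. p n :: real))))"
  have ind: "indep_var ?S X ?T Y"
    unfolding X_def Y_def by (rule indep_N_P)
  have \<Phi>_meas: "\<Phi> \<in> borel_measurable (?S \<Otimes>\<^sub>M ?T)"
  proof -
    have "(\<lambda>z. fst z j) \<in> measurable (?S \<Otimes>\<^sub>M ?T) (count_space UNIV)" for j
      by (intro measurable_compose[OF measurable_fst] measurable_component_singleton) simp
    then have \<nu>: "(\<lambda>z. nat \<lfloor>fst z j\<rfloor>) \<in> measurable (?S \<Otimes>\<^sub>M ?T) (count_space UNIV)" for j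
      by (rule measurable_compose) simp
    have p: "(\<lambda>z. snd z n) \<in> borel_measurable (?S \<Otimes>\<^sub>M ?T)" if "1 \<le> n" for n
      using that by (intro measurable_compose[OF measurable_snd] measurable_component_singleton) simp
    have block: "(\<lambda>z. \<Sum>n\<in>{k<..l}. snd z n) \<in> borel_measurable (?S \<Otimes>\<^sub>M ?T)" for k l
      by (intro borel_measurable_sum p) simp
    \<comment> \<open>The random summation bounds take countably many values; they are made random
      one at a time, the upper one and then the lower one.\<close>
    have "(\<lambda>z. \<Sum>n\<in>{k<..nat \<lfloor>fst z (Suc j)\<rfloor>}. snd z n) \<in> borel_measurable (?S \<Otimes>\<^sub>M ?T)" for k j
      by (rule measurable_compose_countable[OF block \<nu>])
    then have "(\<lambda>z. \<Sum>n\<in>{nat \<lfloor>fst z j\<rfloor><..nat \<lfloor>fst z (Suc j)\<rfloor>}. snd z n)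
        \<in> borel_measurable (?S \<Otimes>\<^sub>M ?T)" for j
      by (rule measurable_compose_countable[OF _ \<nu>])
    note [measurable] = this
    show ?thesis
      unfolding \<Phi>_def case_prod_unfold by measurable
  qed
  have \<Phi>: "\<Phi> (X \<omega>, Y \<omega>') =
      ennreal (exp (\<Sum>j<m. G j * (\<Sum>n\<in>{N (real j) \<omega><..N (real (Suc j)) \<omega>}. P n \<omega>')))" for \<omega> \<omega>'
    by (simp add: \<Phi>_def X_def Y_def)
  have inner: "(\<integral>\<^sup>+\<omega>'. \<Phi> (X \<omega>, Y \<omega>') \<partial>M) =
      (\<Prod>j<m. ennreal ((\<sigma> / (\<sigma> - G j)) ^ (N (real (Suc j)) \<omega> - N (real j) \<omega>)))"
    if \<omega>: "\<omega> \<in> space M" for \<omega>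
  proof -
    let ?\<nu> = "\<lambda>j. N (real j) \<omega>"
    \<comment> \<open>With the counts frozen at \<omega>, each storm gets the weight of its unit
      interval. The bound \<open>c n < \<sigma>\<close> is immediate, since every value of
      \<open>c\<close> is a value of \<open>G\<close>.\<close>
    define c where "c n = G (LEAST i. n \<le> ?\<nu> (Suc i))" for n
    have c: "c n = G j" if "n \<in> {?\<nu> j<..?\<nu> (Suc j)}" for j n
      using block_index[OF N_mono_nat[OF \<omega>] that] by (simp add: c_def)
    have "(\<Sum>j<m. G j * (\<Sum>n\<in>{?\<nu> j<..?\<nu> (Suc j)}. P n \<omega>')) = (\<Sum>n\<in>{?\<nu> 0<..?\<nu> m}. c n * P n \<omega>')" for \<omega>'
      unfolding sum_blocks[OF N_mono_nat[OF \<omega>], symmetric] sum_distrib_left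
      by (intro sum.cong refl) (simp only: c)
    then have "(\<integral>\<^sup>+\<omega>'. \<Phi> (X \<omega>, Y \<omega>') \<partial>M) =
        (\<integral>\<^sup>+\<omega>'. ennreal (exp (\<Sum>n\<in>{?\<nu> 0<..?\<nu> m}. c n * P n \<omega>')) \<partial>M)"
      by (simp add: \<Phi>)
    also have "\<dots> = (\<Prod>n\<in>{?\<nu> 0<..?\<nu> m}. ennreal (\<sigma> / (\<sigma> - c n)))"
      by (rule nn_integral_exp_weighted_depths) (auto simp: c_def G)
    also have "\<dots> = (\<Prod>j<m. \<Prod>n\<in>{?\<nu> j<..?\<nu> (Suc j)}. ennreal (\<sigma> / (\<sigma> - c n)))"
      by (rule prod_blocks[OF N_mono_nat[OF \<omega>], symmetric])
    also have "\<dots> = (\<Prod>j<m. \<Prod>n\<in>{?\<nu> j<..?\<nu> (Suc j)}. ennreal (\<sigma> / (\<sigma> - G j)))"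
      by (intro prod.cong refl) (simp only: c)
    also have "\<dots> = (\<Prod>j<m. ennreal ((\<sigma> / (\<sigma> - G j)) ^ (?\<nu> (Suc j) - ?\<nu> j)))"
      using G \<sigma>_pos by (intro prod.cong refl) (simp add: ennreal_power less_imp_le)
    finally show ?thesis .
  qed
  have "(\<integral>\<^sup>+\<omega>. \<Phi> (X \<omega>, Y \<omega>) \<partial>M) = (\<integral>\<^sup>+\<omega>. \<integral>\<^sup>+\<omega>'. \<Phi> (X \<omega>, Y \<omega>') \<partial>M \<partial>M)"
    by (rule nn_integral_indep_var[OF ind \<Phi>_meas])
  also have "\<dots> = (\<integral>\<^sup>+\<omega>. (\<Prod>j<m. ennreal ((\<sigma> / (\<sigma> - G j)) ^ (N (real (Suc j)) \<omega> - N (real j) \<omega>))) \<partial>M)"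
    by (intro nn_integral_cong inner)
  also have "\<dots> = ennreal (exp (rate * (\<Sum>j<m. \<sigma> / (\<sigma> - G j) - 1)))"
    using G \<sigma>_pos by (intro nn_integral_prod_increments) (simp add: less_imp_le)
  also have "(\<Sum>j<m. \<sigma> / (\<sigma> - G j) - 1) = (\<Sum>j<m. G j / (\<sigma> - G j))"
  proof (intro sum.cong refl)
    show "\<sigma> / (\<sigma> - G j) - 1 = G j / (\<sigma> - G j)" for j
      using G(2)[of j] by (simp add: field_simps)
  qed
  finally show ?thesis
    by (simp add: \<Phi>)
qed

section \<open>Tail bounds for the scalar shot noise\<close>

definition shot_noise :: "(real \<Rightarrow> real) \<Rightarrow> real \<Rightarrow> 'w \<Rightarrow> real" where
  "shot_noise f t \<omega> = (\<Sum>n = 1..N t \<omega>. P n \<omega> * f (t - jump_time N n \<omega>))"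

lemma shot_noise_measurable:
  assumes [measurable]: "f \<in> borel_measurable borel" and t: "0 \<le> t"
  shows "shot_noise f t \<in> borel_measurable M"
proof -
  \<comment> \<open>The truncated jump time is measurable and agrees with the true one for every
    storm that enters the sum.\<close>
  let ?U = "\<lambda>n \<omega>. if n \<le> N t \<omega> then jump_time N n \<omega> else 0"
  note [measurable] = N_measurable[OF t] jump_time_measurable[OF t]
  have "(\<lambda>\<omega>. \<Sum>n = 1..k. P n \<omega> * f (t - ?U n \<omega>)) \<in> borel_measurable M" for k
    by (intro borel_measurable_sum borel_measurable_times P_measurable) (simp, measurable)
  then have "(\<lambda>\<omega>. \<Sum>n = 1..N t \<omega>. P n \<omega> * f (t - ?U n \<omega>)) \<in> borel_measurable M"
    by (rule measurable_compose_countable[OF _ N_measurable[OF t]])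
  also have "(\<lambda>\<omega>. \<Sum>n = 1..N t \<omega>. P n \<omega> * f (t - ?U n \<omega>)) = shot_noise f t"
    unfolding shot_noise_def by (intro ext sum.cong) auto
  finally show ?thesis .
qed

text \<open>At time m a storm that fell by time j + 1 has age at least m - (j + 1). A lower bound on
  the age is enough, because \<open>F j\<close> dominates \<open>f\<close> on all of
  \<open>{real j..}\<close>.\<close>

lemma shot_noise_le_blocks:
  assumes \<omega>: "\<omega> \<in> space M" and P: "\<And>n. 1 \<le> n \<Longrightarrow> 0 \<le> P n \<omega>"
    and f: "\<And>j s. real j \<le> s \<Longrightarrow> f s \<le> F j"
  shows "shot_noise f (real m) \<omega> \<le>
    (\<Sum>j<m. F (m - Suc j) * (\<Sum>n\<in>{N (real j) \<omega><..N (real (Suc j)) \<omega>}. P n \<omega>))"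
proof -
  let ?h = "\<lambda>n. P n \<omega> * f (real m - jump_time N n \<omega>)"
  have "{1..N (real m) \<omega>} = {N (real 0) \<omega><..N (real m) \<omega>}"
    using N_0[OF \<omega>] by auto
  then have "shot_noise f (real m) \<omega> = (\<Sum>n\<in>{N (real 0) \<omega><..N (real m) \<omega>}. ?h n)"
    by (simp add: shot_noise_def)
  also have "\<dots> = (\<Sum>j<m. \<Sum>n\<in>{N (real j) \<omega><..N (real (Suc j)) \<omega>}. ?h n)"
    by (rule sum_blocks[OF N_mono_nat[OF \<omega>], symmetric])
  also have "\<dots> \<le> (\<Sum>j<m. \<Sum>n\<in>{N (real j) \<omega><..N (real (Suc j)) \<omega>}. P n \<omega> * F (m - Suc j))"
  proof (intro sum_mono mult_left_mono)
    fix j n assume j: "j \<in> {..<m}" and n: "n \<in> {N (real j) \<omega><..N (real (Suc j)) \<omega>}"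
    have "jump_time N n \<omega> \<le> real (Suc j)"
      using jump_time_le_iff[OF \<omega>, of "real (Suc j)" n "real (Suc j)"] n by simp
    then show "f (real m - jump_time N n \<omega>) \<le> F (m - Suc j)"
      using j by (intro f) (simp add: of_nat_diff)
    show "0 \<le> P n \<omega>"
      using n by (intro P) simp
  qed
  also have "\<dots> = (\<Sum>j<m. F (m - Suc j) * (\<Sum>n\<in>{N (real j) \<omega><..N (real (Suc j)) \<omega>}. P n \<omega>))"
    by (simp add: sum_distrib_left mult.commute)
  finally show ?thesis .
qed

text \<open>Chernoff's bound. The constant must not depend on \<open>m\<close>, since the
  observation time is later sent to infinity.\<close>

lemma shot_noise_tail_upper:
  assumes f: "f \<in> borel_measurable borel"
    and L: "0 < L" "\<And>s. 0 \<le> s \<Longrightarrow> f s \<le> L"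
    and C: "0 < c" "0 < C" "\<And>s. 0 \<le> s \<Longrightarrow> f s \<le> C * exp (- c * s)"
    and \<theta>: "0 < \<theta>" "\<theta> * L < \<sigma>"
  shows "\<exists>B. \<forall>m x. prob {\<omega> \<in> space M. x < shot_noise f (real m) \<omega>} \<le> B * exp (- \<theta> * x)"
proof -
  \<comment> \<open>The cap \<open>L\<close> keeps \<open>\<theta> * F j\<close> below \<sigma>, so
    that the exponential moments are finite; the exponential factor makes the sum over all ages
    converge.\<close>
  define F where "F j = min L (C * exp (- c * real j))" for j :: nat
  have F: "0 \<le> \<theta> * F j" "\<theta> * F j < \<sigma>" for j
  proof -
    show "0 \<le> \<theta> * F j"
      using L(1) C(2) \<theta>(1) by (simp add: F_def)
    have "\<theta> * F j \<le> \<theta> * L"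
      using \<theta>(1) by (intro mult_left_mono) (auto simp: F_def)
    then show "\<theta> * F j < \<sigma>"
      using \<theta>(2) by simp
  qed
  define D where "D = \<theta> * C / (\<sigma> - \<theta> * L)"
  define B where "B = exp (rate * (D * (1 / (1 - exp (- c)))))"
  have D_pos: "0 < D"
    using \<theta> C by (simp add: D_def)
  have sum_le: "(\<Sum>j<m. \<theta> * F (m - Suc j) / (\<sigma> - \<theta> * F (m - Suc j))) \<le> D * (1 / (1 - exp (- c)))" for m
  proof -
    \<comment> \<open>The numerator is estimated by the exponential part of \<open>F\<close>, the
      denominator by the cap.\<close>
    have "\<theta> * F j / (\<sigma> - \<theta> * F j) \<le> \<theta> * (C * exp (- c * real j)) / (\<sigma> - \<theta> * L)" for j
      using \<theta> L(1) C(2) by (intro frac_le mult_left_mono diff_left_mono) (auto simp: F_def)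
    also have "\<theta> * (C * exp (- c * real j)) / (\<sigma> - \<theta> * L) = D * exp (- c) ^ j" for j
      by (simp add: D_def mult_ac flip: exp_of_nat_mult)
    finally have "(\<Sum>j<m. \<theta> * F j / (\<sigma> - \<theta> * F j)) \<le> (\<Sum>j<m. D * exp (- c) ^ j)"
      by (intro sum_mono)
    also have "\<dots> = D * (\<Sum>j<m. exp (- c) ^ j)"
      by (simp add: sum_distrib_left)
    also have "\<dots> \<le> D * (\<Sum>j. exp (- c) ^ j)"
      using C(1) D_pos by (intro mult_left_mono sum_le_suminf summable_geometric) auto
    also have "(\<Sum>j. exp (- c) ^ j) = 1 / (1 - exp (- c))"
      using C(1) by (intro suminf_geometric) simp
    finally show ?thesis
      by (subst sum.nat_diff_reindex)
  qed
  have "prob {\<omega> \<in> space M. x < shot_noise f (real m) \<omega>} \<le> B * exp (- \<theta> * x)" for m x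
  proof -
    let ?S = "shot_noise f (real m)"
    have [measurable]: "?S \<in> borel_measurable M"
      by (rule shot_noise_measurable[OF f]) simp
    have f_le: "f s \<le> F j" if "real j \<le> s" for j s
    proof -
      have "C * exp (- c * s) \<le> C * exp (- c * real j)"
        using that C by simp
      then show ?thesis
        using that L(2)[of s] C(3)[of s] by (simp add: F_def)
    qed
    have "(\<integral>\<^sup>+\<omega>. ennreal (exp (\<theta> * ?S \<omega>)) \<partial>M) \<le>
        (\<integral>\<^sup>+\<omega>. ennreal (exp (\<Sum>j<m. \<theta> * F (m - Suc j) *
          (\<Sum>n\<in>{N (real j) \<omega><..N (real (Suc j)) \<omega>}. P n \<omega>))) \<partial>M)"
    proof (rule nn_integral_mono_AE)
      show "AE \<omega> in M. ennreal (exp (\<theta> * ?S \<omega>)) \<le> ennreal (exp (\<Sum>j<m. \<theta> * F (m - Suc j) *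
          (\<Sum>n\<in>{N (real j) \<omega><..N (real (Suc j)) \<omega>}. P n \<omega>)))"
        using P_pos AE_space
      proof eventually_elim
        case (elim \<omega>)
        have "\<theta> * ?S \<omega> \<le> \<theta> * (\<Sum>j<m. F (m - Suc j) *
            (\<Sum>n\<in>{N (real j) \<omega><..N (real (Suc j)) \<omega>}. P n \<omega>))"
          using elim \<theta>(1) f_le by (intro mult_left_mono shot_noise_le_blocks) (auto intro: less_imp_le)
        then show ?case
          by (simp add: sum_distrib_left mult.assoc ennreal_leI)
      qed
    qed
    also have "\<dots> = ennreal (exp (rate * (\<Sum>j<m. \<theta> * F (m - Suc j) / (\<sigma> - \<theta> * F (m - Suc j)))))"
      by (rule nn_integral_exp_block_depths) (rule F)+
    also have "\<dots> \<le> ennreal B"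
      unfolding B_def exp_le_cancel_iff
      by (intro ennreal_leI exp_mono mult_left_mono sum_le less_imp_le[OF rate_pos])
    finally have mgf: "(\<integral>\<^sup>+\<omega>. ennreal (exp (\<theta> * ?S \<omega>)) \<partial>M) \<le> ennreal B" .
    have "emeasure M {\<omega> \<in> space M. x < ?S \<omega>} \<le>
        emeasure M {\<omega> \<in> space M. 1 \<le> ennreal (exp (- \<theta> * x)) * ennreal (exp (\<theta> * ?S \<omega>))}"
    proof (rule emeasure_mono)
      show "{\<omega> \<in> space M. x < ?S \<omega>} \<subseteq>
          {\<omega> \<in> space M. 1 \<le> ennreal (exp (- \<theta> * x)) * ennreal (exp (\<theta> * ?S \<omega>))}"
        using \<theta>(1) by (auto simp: simp flip: ennreal_mult exp_add)
    qed measurable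
    also have "\<dots> \<le> ennreal (exp (- \<theta> * x)) *
        (\<integral>\<^sup>+\<omega>. ennreal (exp (\<theta> * ?S \<omega>)) * indicator (space M) \<omega> \<partial>M)"
      by (rule nn_integral_Markov_inequality) auto
    also have "(\<integral>\<^sup>+\<omega>. ennreal (exp (\<theta> * ?S \<omega>)) * indicator (space M) \<omega> \<partial>M) =
        (\<integral>\<^sup>+\<omega>. ennreal (exp (\<theta> * ?S \<omega>)) \<partial>M)"
      by (intro nn_integral_cong) simp
    also have "ennreal (exp (- \<theta> * x)) * \<dots> \<le> ennreal (exp (- \<theta> * x)) * ennreal B"
      by (intro mult_left_mono mgf) simp
    also have "\<dots> = ennreal (B * exp (- \<theta> * x))"
      by (simp add: B_def mult.commute flip: ennreal_mult)
    finally show ?thesis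
      by (simp add: emeasure_eq_measure B_def)
  qed
  then show ?thesis
    by blast
qed

text \<open>
  A single storm in the first unit of time produces the lower bound: wherever it falls, some point
  of a fine enough finite grid of observation times sees it while \<open>f\<close> still exceeds \<open>l\<close>.
\<close>

lemma shot_noise_tail_lower:
  assumes f: "f \<in> borel_measurable borel" "\<And>s. 0 \<le> s \<Longrightarrow> 0 \<le> f s"
    and s: "0 \<le> s" "isCont f s" and l: "0 < l" "l < f s"
  obtains I c where "finite I" "I \<subseteq> {0<..}" "0 < c"
    "\<And>x. 0 \<le> x \<Longrightarrow> c * exp (- (\<sigma> / l) * x) \<le> (\<Sum>t\<in>I. prob {\<omega> \<in> space M. x < shot_noise f t \<omega>})"
proof -
  have "eventually (\<lambda>u. l < f u) (at s)"
    using s(2) l(2) by (intro order_tendstoD(1)) (auto simp: isCont_def)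
  then obtain d where d: "0 < d" "\<And>u. u \<noteq> s \<Longrightarrow> dist u s < d \<Longrightarrow> l < f u"
    by (auto simp: eventually_at)
  define \<delta> where "\<delta> = d / 2"
  have \<delta>: "0 < \<delta>"
    using d(1) by (simp add: \<delta>_def)
  have window: "l < f u" if "s \<le> u" "u \<le> s + \<delta>" for u
  proof (cases "u = s")
    case False
    then show ?thesis
      using that d(1) by (intro d(2)) (auto simp: \<delta>_def dist_real_def)
  qed (use l in simp)
  \<comment> \<open>The storm falls in [0, 1], so multiples of \<delta> up to the first one beyond 1
    suffice as offsets.\<close>
  define I where "I = (\<lambda>k. s + real k * \<delta>) ` {1..nat \<lfloor>1 / \<delta>\<rfloor> + 1}"
  have I_pos: "I \<subseteq> {0<..}"
    using s(1) \<delta> by (auto simp: I_def intro!: add_nonneg_pos)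
  \<comment> \<open>The depth is paired only with the count at time 1, not with the storm time; the
    probability of the joint event therefore factors.\<close>
  have "indep_var borel (\<lambda>\<omega>. real (N 1 \<omega>)) borel (P 1)"
  proof -
    have "indep_var borel ((\<lambda>\<nu>. \<nu> 1) \<circ> (\<lambda>\<omega> j. real (N (real j) \<omega>))) borel
        ((\<lambda>p. p 1) \<circ> (\<lambda>\<omega>. \<lambda>n\<in>{1..}. P n \<omega>))"
    proof (rule indep_var_compose[OF indep_N_P])
      show "(\<lambda>\<nu> :: nat \<Rightarrow> real. \<nu> 1) \<in> measurable (PiM UNIV (\<lambda>_. count_space UNIV)) (borel :: real measure)"
        by (rule measurable_compose[OF measurable_component_singleton]) simp_all
      show "(\<lambda>p :: nat \<Rightarrow> real. p 1) \<in> measurable (PiM {1..} (\<lambda>_. borel)) (borel :: real measure)"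
        by (rule measurable_component_singleton) simp
    qed
    then show ?thesis
      by (simp add: comp_def)
  qed
  note ind = this
  define c where "c = prob {\<omega> \<in> space M. 1 \<le> N 1 \<omega>}"
  have "c * exp (- (\<sigma> / l) * x) \<le> (\<Sum>t\<in>I. prob {\<omega> \<in> space M. x < shot_noise f t \<omega>})" if x: "0 \<le> x" for x
  proof -
    have meas: "{\<omega> \<in> space M. x < shot_noise f t \<omega>} \<in> sets M" if "t \<in> I" for t
    proof -
      have [measurable]: "shot_noise f t \<in> borel_measurable M"
        using that I_pos by (intro shot_noise_measurable f(1)) auto
      show ?thesis
        by measurable
    qed
    have "prob {\<omega> \<in> space M. x / l < P 1 \<omega>} = exp (- (x / l) * \<sigma>)"
      using x l(1) by (intro exponential_distributedD_gt[OF exponential _ \<sigma>_pos]) simp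
    then have "c * exp (- (\<sigma> / l) * x) =
        prob {\<omega> \<in> space M. 1 \<le> real (N 1 \<omega>)} * prob {\<omega> \<in> space M. x / l < P 1 \<omega>}"
      by (simp add: c_def mult.commute)
    also have "\<dots> = prob {\<omega> \<in> space M. 1 \<le> real (N 1 \<omega>) \<and> x / l < P 1 \<omega>}"
      using prob_indep_random_variable[OF ind, of "{1..}" "{x / l<..}"] by simp
    also have "\<dots> \<le> prob (\<Union>t\<in>I. {\<omega> \<in> space M. x < shot_noise f t \<omega>})"
    proof (rule finite_measure_mono_AE)
      show "AE \<omega> in M. \<omega> \<in> {\<omega> \<in> space M. 1 \<le> real (N 1 \<omega>) \<and> x / l < P 1 \<omega>} \<longrightarrow>
          \<omega> \<in> (\<Union>t\<in>I. {\<omega> \<in> space M. x < shot_noise f t \<omega>})"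
        using P_pos AE_space
      proof eventually_elim
        case (elim \<omega>)
        show ?case
        proof
          assume "\<omega> \<in> {\<omega> \<in> space M. 1 \<le> real (N 1 \<omega>) \<and> x / l < P 1 \<omega>}"
          then have N1: "1 \<le> N 1 \<omega>" and P1: "x / l < P 1 \<omega>"
            by auto
          let ?T = "jump_time N 1 \<omega>"
          have T: "0 \<le> ?T" "?T \<le> 1"
            using jump_time_nonneg[of 1 1 \<omega>] jump_time_le_iff[OF elim(2), of 1 1 1] N1 by auto
          \<comment> \<open>The next multiple of \<delta> after the storm time exceeds it by at most
            \<delta>, so the age at time \<open>t\<close> lies between \<open>s\<close> and
            \<open>s + \<delta>\<close>.\<close>
          define k where "k = nat \<lfloor>?T / \<delta>\<rfloor> + 1"
          define t where "t = s + real k * \<delta>"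
          have "?T / \<delta> \<le> 1 / \<delta>"
            using T(2) \<delta> by (simp add: divide_right_mono)
          then have "t \<in> I"
            unfolding t_def I_def k_def by (intro imageI) (simp add: nat_mono floor_mono)
          then have t: "0 < t"
            using I_pos by auto
          have "real k = of_int \<lfloor>?T / \<delta>\<rfloor> + 1"
            using T(1) \<delta> by (simp add: k_def)
          then have "?T / \<delta> \<le> real k" "real k \<le> ?T / \<delta> + 1"
            by linarith+
          then have grid: "?T \<le> real k * \<delta>" "real k * \<delta> \<le> ?T + \<delta>"
            using \<delta> by (simp_all add: field_simps)
          then have f_gt: "l < f (t - ?T)"
            by (intro window) (auto simp: t_def)
          have Nt: "1 \<le> N t \<omega>"
            using jump_time_le_iff[OF elim(2), of 1 1 t] N1 t grid(1) s(1) by (simp add: t_def)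
          have "x = x / l * l"
            using l(1) by simp
          also have "\<dots> \<le> x / l * f (t - ?T)"
            using x l(1) f_gt by (intro mult_left_mono) auto
          also have "\<dots> < P 1 \<omega> * f (t - ?T)"
            using P1 l(1) f_gt by (intro mult_strict_right_mono) auto
          \<comment> \<open>The other storms up to time \<open>t\<close> contribute nonnegative
            amounts and can only help.\<close>
          also have "\<dots> \<le> (\<Sum>n = 1..N t \<omega>. P n \<omega> * f (t - jump_time N n \<omega>))"
          proof (rule member_le_sum)
            fix n assume n: "n \<in> {1..N t \<omega>} - {1}"
            then have "jump_time N n \<omega> \<le> t"
              using jump_time_le_iff[OF elim(2), of t n t] t by auto
            moreover have "0 < P n \<omega>"
              using n elim(1) by auto
            ultimately show "0 \<le> P n \<omega> * f (t - jump_time N n \<omega>)"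
              by (intro mult_nonneg_nonneg f(2)) auto
          qed (use Nt in auto)
          finally have "x < shot_noise f t \<omega>"
            by (simp add: shot_noise_def)
          then show "\<omega> \<in> (\<Union>t\<in>I. {\<omega> \<in> space M. x < shot_noise f t \<omega>})"
            using elim(2) \<open>t \<in> I\<close> by blast
        qed
      qed
      show "(\<Union>t\<in>I. {\<omega> \<in> space M. x < shot_noise f t \<omega>}) \<in> sets M"
        using meas by (intro sets.finite_UN) (auto simp: I_def)
    qed
    also have "\<dots> \<le> (\<Sum>t\<in>I. prob {\<omega> \<in> space M. x < shot_noise f t \<omega>})"
      using meas by (intro measure_UNION_le) (auto simp: I_def)
    finally show ?thesis .
  qed
  moreover have "0 < c"
    unfolding c_def by (rule N_positive_prob) simp
  moreover have "finite I"
    by (simp add: I_def)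
  ultimately show ?thesis
    using I_pos that by blast
qed

end

section \<open>The tail of the invariant distribution\<close>

text \<open>Exponential bounds with rates arbitrarily close to \<open>L\<close> on either side
  determine the limit: the constant prefactor contributes \<open>ln c / x\<close>, which
  vanishes.\<close>

lemma log_tail_limit:
  fixes p :: "real \<Rightarrow> real"
  assumes "0 < L"
    and upper: "\<And>\<theta>. 0 < \<theta> \<Longrightarrow> \<theta> < L \<Longrightarrow> \<exists>C. \<forall>x. p x \<le> C * exp (- \<theta> * x)"
    and lower: "\<And>\<theta>. L < \<theta> \<Longrightarrow> \<exists>c>0. \<forall>x\<ge>0. c * exp (- \<theta> * x) \<le> p x"
  shows "((\<lambda>x. 1 / x * ln (p x)) \<longlongrightarrow> - L) at_top"
proof (rule order_tendstoI)
  have lim: "((\<lambda>x. ln c / x - \<theta>) \<longlongrightarrow> 0 - \<theta>) at_top" for c \<theta> :: real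
    by (intro tendsto_diff tendsto_const tendsto_divide_0[OF tendsto_const]
        filterlim_at_top_imp_at_infinity filterlim_ident)
  have split: "1 / x * ln (c * exp (- \<theta> * x)) = ln c / x - \<theta>" if "0 < c" "0 < x" for c \<theta> x :: real
    using that by (simp add: ln_mult field_simps)
  fix y
  {
    assume "y < - L"
    then obtain \<theta> where \<theta>: "L < \<theta>" "\<theta> < - y"
      using dense[of L "- y"] by auto
    obtain c where c: "0 < c" "\<And>x. 0 \<le> x \<Longrightarrow> c * exp (- \<theta> * x) \<le> p x"
      using lower[OF \<theta>(1)] by auto
    have "eventually (\<lambda>x. y < ln c / x - \<theta>) at_top"
      using \<theta> by (intro order_tendstoD[OF lim]) auto
    then show "eventually (\<lambda>x. y < 1 / x * ln (p x)) at_top"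
      using eventually_gt_at_top[of 0]
    proof eventually_elim
      case (elim x)
      have "0 < c * exp (- \<theta> * x)"
        using c by simp
      then have "1 / x * ln (c * exp (- \<theta> * x)) \<le> 1 / x * ln (p x)"
        using elim c(2)[of x] by (intro mult_left_mono) auto
      then show ?case
        using elim split[OF c(1), of x \<theta>] by linarith
    qed
  next
    assume "- L < y"
    then obtain \<theta> where \<theta>: "0 < \<theta>" "- y < \<theta>" "\<theta> < L"
      using dense[of "max 0 (- y)" L] \<open>0 < L\<close> by auto
    obtain C where C: "\<And>x. p x \<le> C * exp (- \<theta> * x)"
      using upper[OF \<theta>(1,3)] by auto
    \<comment> \<open>A lower bound at some rate, here \<open>L + 1\<close>, gives positivity of
      \<open>p x\<close>, which monotonicity of \<open>ln\<close> requires.\<close>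
    obtain c where c: "0 < c" "\<And>x. 0 \<le> x \<Longrightarrow> c * exp (- (L + 1) * x) \<le> p x"
      using lower[of "L + 1"] by auto
    have p_pos: "0 < p x" if "0 \<le> x" for x
      using c(2)[OF that] mult_pos_pos[OF c(1) exp_gt_zero, of "- (L + 1) * x"] by linarith
    have "0 < C"
      using C[of 0] p_pos[of 0] by simp
    have "eventually (\<lambda>x. ln C / x - \<theta> < y) at_top"
      using \<theta> by (intro order_tendstoD[OF lim]) auto
    then show "eventually (\<lambda>x. 1 / x * ln (p x) < y) at_top"
      using eventually_gt_at_top[of 0]
    proof eventually_elim
      case (elim x)
      have "1 / x * ln (p x) \<le> 1 / x * ln (C * exp (- \<theta> * x))"
        using elim C[of x] p_pos[of x] by (intro mult_left_mono) auto
      then show ?case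
        using elim split[OF \<open>0 < C\<close>, of x \<theta>] by linarith
    qed
  }
qed

section \<open>Comparison of the invariant law with the shot noise\<close>

lemma borel_measurable_vec_iff:
  fixes f :: "'a \<Rightarrow> real^'n"
  shows "f \<in> borel_measurable M \<longleftrightarrow> (\<forall>i. (\<lambda>x. f x $ i) \<in> borel_measurable M)"
  unfolding borel_measurable_euclidean_space[of f M]
  by (auto simp: Basis_vec_def inner_axis)

lemma (in pair_prob_space) measure_pair_times:
  assumes "A \<in> sets M1" "B \<in> sets M2"
  shows "measure (M1 \<Otimes>\<^sub>M M2) (A \<times> B) = measure M1 A * measure M2 B"
  using assms by (simp add: measure_def M2.emeasure_pair_measure_Times enn2real_mult)

lemma borel_measurable_matrix_exp_mult_nth:
  "(\<lambda>s. (matrix_exp (s *\<^sub>R A) *v b) $ i) \<in> borel_measurable borel"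
  unfolding matrix_vector_mult_nth by measurable

lemma (in poisson_rainfall) shot_noise_state_nth:
  "shot_noise_state A b N P x t \<omega> $ i =
    (\<Sum>j\<in>UNIV. matrix_exp (t *\<^sub>R A) $ i $ j * x $ j)
      + shot_noise (\<lambda>s. (matrix_exp (s *\<^sub>R A) *v b) $ i) t \<omega>"
  by (simp add: shot_noise_state_def shot_noise_def matrix_vector_mult_scaleR matrix_vector_mult_nth)

lemma (in poisson_rainfall) shot_noise_state_measurable:
  assumes "0 \<le> t" "sets g = sets borel"
  shows "(\<lambda>(x, \<omega>). shot_noise_state A b N P x t \<omega>) \<in> borel_measurable (g \<Otimes>\<^sub>M M)"
  unfolding borel_measurable_vec_iff case_prod_unfold shot_noise_state_nth
proof (intro allI borel_measurable_add borel_measurable_sum borel_measurable_times borel_measurable_const)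
  fix i j
  have "(\<lambda>x. x $ j) \<in> borel_measurable g"
    using assms(2) by (simp cong: measurable_cong_sets)
  then show "(\<lambda>z. fst z $ j) \<in> borel_measurable (g \<Otimes>\<^sub>M M)"
    by (rule measurable_compose[OF measurable_fst])
  have "shot_noise (\<lambda>s. (matrix_exp (s *\<^sub>R A) *v b) $ i) t \<in> borel_measurable M"
    by (intro shot_noise_measurable borel_measurable_matrix_exp_mult_nth assms(1))
  then show "(\<lambda>z. shot_noise (\<lambda>s. (matrix_exp (s *\<^sub>R A) *v b) $ i) t (snd z)) \<in> borel_measurable (g \<Otimes>\<^sub>M M)"
    by (rule measurable_compose[OF measurable_snd])
qed

text \<open>The left side does not depend on \<open>t\<close>, so every positive observation time is
  available: large integers for the upper bound, the grid for the lower bound.\<close>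

lemma (in poisson_rainfall) invariant_tail_eq:
  assumes "invariant_distribution M (shot_noise_state A b N P) g" "0 < t"
  shows "measure g {v. x < v $ i} = measure (g \<Otimes>\<^sub>M M)
    {z \<in> space (g \<Otimes>\<^sub>M M). x < (\<Sum>j\<in>UNIV. matrix_exp (t *\<^sub>R A) $ i $ j * fst z $ j)
      + shot_noise (\<lambda>s. (matrix_exp (s *\<^sub>R A) *v b) $ i) t (snd z)}"
proof -
  have sets: "sets g = sets borel"
    and distr: "distr (g \<Otimes>\<^sub>M M) borel (\<lambda>(x, \<omega>). shot_noise_state A b N P x t \<omega>) = g"
    using assms unfolding invariant_distribution_def by auto
  have "measure g {v. x < v $ i} =
      measure (distr (g \<Otimes>\<^sub>M M) borel (\<lambda>(x, \<omega>). shot_noise_state A b N P x t \<omega>)) {v. x < v $ i}"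
    by (simp only: distr)
  also have "\<dots> = measure (g \<Otimes>\<^sub>M M)
      ((\<lambda>(x, \<omega>). shot_noise_state A b N P x t \<omega>) -` {v. x < v $ i} \<inter> space (g \<Otimes>\<^sub>M M))"
    using assms(2) by (intro measure_distr shot_noise_state_measurable sets) simp_all
  also have "(\<lambda>(x, \<omega>). shot_noise_state A b N P x t \<omega>) -` {v. x < v $ i} \<inter> space (g \<Otimes>\<^sub>M M) =
      {z \<in> space (g \<Otimes>\<^sub>M M). x < (\<Sum>j\<in>UNIV. matrix_exp (t *\<^sub>R A) $ i $ j * fst z $ j)
        + shot_noise (\<lambda>s. (matrix_exp (s *\<^sub>R A) *v b) $ i) t (snd z)}"
    by (auto simp: case_prod_unfold shot_noise_state_nth)
  finally show ?thesis .
qed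

text \<open>The initial state is almost surely positive and the exponential is nonnegative, so
  dropping the initial contribution only shrinks the event.\<close>

lemma (in poisson_rainfall) shot_noise_tail_le_invariant_tail:
  assumes inv: "invariant_distribution M (shot_noise_state A b N P) g"
    and A: "metzler A" and t: "0 < t"
  shows "prob {\<omega> \<in> space M. x < shot_noise (\<lambda>s. (matrix_exp (s *\<^sub>R A) *v b) $ i) t \<omega>} \<le>
    measure g {v. x < v $ i}"
proof -
  let ?S = "shot_noise (\<lambda>s. (matrix_exp (s *\<^sub>R A) *v b) $ i) t"
  have g: "prob_space g" "sets g = sets borel" and pos: "AE y in g. \<forall>i. 0 < y $ i"
    using inv unfolding invariant_distribution_def by auto
  interpret g: prob_space g
    by fact
  interpret gM: pair_prob_space g M ..
  have [measurable]: "?S \<in> borel_measurable M"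
    using t by (intro shot_noise_measurable borel_measurable_matrix_exp_mult_nth) simp
  have nth [measurable]: "(\<lambda>x. x $ j) \<in> borel_measurable g" for j
    using g(2) by (simp cong: measurable_cong_sets)
  have "prob {\<omega> \<in> space M. x < ?S \<omega>} = measure (g \<Otimes>\<^sub>M M) (space g \<times> {\<omega> \<in> space M. x < ?S \<omega>})"
    by (simp add: gM.measure_pair_times g.prob_space)
  also have "\<dots> \<le> measure (g \<Otimes>\<^sub>M M) {z \<in> space (g \<Otimes>\<^sub>M M).
      x < (\<Sum>j\<in>UNIV. matrix_exp (t *\<^sub>R A) $ i $ j * fst z $ j) + ?S (snd z)}"
  proof (rule gM.finite_measure_mono_AE)
    have "AE z in g \<Otimes>\<^sub>M M. \<forall>i. 0 < fst z $ i"
    proof (rule gM.AE_pair_measure)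
      show "{z \<in> space (g \<Otimes>\<^sub>M M). \<forall>i. 0 < fst z $ i} \<in> sets (g \<Otimes>\<^sub>M M)"
        by measurable
      show "AE y in g. AE \<omega> in M. \<forall>i. 0 < fst (y, \<omega>) $ i"
        using pos by simp
    qed
    then show "AE z in g \<Otimes>\<^sub>M M. z \<in> space g \<times> {\<omega> \<in> space M. x < ?S \<omega>} \<longrightarrow>
        z \<in> {z \<in> space (g \<Otimes>\<^sub>M M).
          x < (\<Sum>j\<in>UNIV. matrix_exp (t *\<^sub>R A) $ i $ j * fst z $ j) + ?S (snd z)}"
    proof eventually_elim
      case (elim z)
      have "0 \<le> (\<Sum>j\<in>UNIV. matrix_exp (t *\<^sub>R A) $ i $ j * fst z $ j)"
        using A t elim by (intro sum_nonneg mult_nonneg_nonneg matrix_exp_nonneg) (auto intro: less_imp_le)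
      then show ?case
        by (auto simp: space_pair_measure)
    qed
  qed measurable
  also have "\<dots> = measure g {v. x < v $ i}"
    by (rule invariant_tail_eq[OF inv t, symmetric])
  finally show ?thesis .
qed

text \<open>The initial state is forgotten: it costs one unit of the threshold and a vanishing probability.\<close>

lemma (in poisson_rainfall) invariant_tail_le:
  assumes inv: "invariant_distribution M (shot_noise_state A b N P) g"
    and decay: "\<And>j. (\<lambda>m. matrix_exp (real m *\<^sub>R A) $ i $ j) \<longlonglongrightarrow> 0"
    and bound: "\<And>m. prob {\<omega> \<in> space M. x - 1 < shot_noise (\<lambda>s. (matrix_exp (s *\<^sub>R A) *v b) $ i) (real m) \<omega>} \<le> p"
  shows "measure g {v. x < v $ i} \<le> p"
proof -
  let ?S = "\<lambda>m. shot_noise (\<lambda>s. (matrix_exp (s *\<^sub>R A) *v b) $ i) (real m)"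
  let ?X = "\<lambda>m y. \<Sum>j\<in>UNIV. matrix_exp (real m *\<^sub>R A) $ i $ j * y $ j"
  have g: "prob_space g" "sets g = sets borel"
    using inv unfolding invariant_distribution_def by auto
  interpret g: prob_space g
    by fact
  interpret gM: pair_prob_space g M ..
  have [measurable]: "?S m \<in> borel_measurable M" for m
    by (intro shot_noise_measurable borel_measurable_matrix_exp_mult_nth) simp
  have nth [measurable]: "(\<lambda>x. x $ j) \<in> borel_measurable g" for j
    using g(2) by (simp cong: measurable_cong_sets)
  define q where "q m = measure g {y \<in> space g. 1 < ?X m y}" for m
  have "q \<longlonglongrightarrow> 0"
  proof -
    \<comment> \<open>For each fixed \<open>y\<close> the initial contribution tends to 0, so the
      indicator is eventually 0; dominated convergence passes this to probabilities.\<close>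
    have "(\<lambda>m. \<integral>y. indicator {y \<in> space g. 1 < ?X m y} y \<partial>g) \<longlonglongrightarrow> (\<integral>y. 0 \<partial>g :: real)"
    proof (rule integral_dominated_convergence[where w="\<lambda>_. 1"])
      show "AE y in g. (\<lambda>m. indicator {y \<in> space g. 1 < ?X m y} y) \<longlonglongrightarrow> (0 :: real)"
      proof (rule AE_I2)
        fix y
        have "(\<lambda>m. ?X m y) \<longlonglongrightarrow> (\<Sum>j\<in>UNIV. 0 * y $ j)"
          by (intro tendsto_sum tendsto_mult decay tendsto_const)
        then have "eventually (\<lambda>m. ?X m y < 1) sequentially"
          by (intro order_tendstoD) auto
        then have "eventually (\<lambda>m. indicator {y \<in> space g. 1 < ?X m y} y = (0 :: real)) sequentially"
          by eventually_elim (auto simp: indicator_def)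
        then show "(\<lambda>m. indicator {y \<in> space g. 1 < ?X m y} y) \<longlonglongrightarrow> (0 :: real)"
          by (rule tendsto_eventually)
      qed
    qed (auto simp: indicator_def)
    then show ?thesis
      by (simp add: q_def[abs_def] Int_absorb2 subset_eq)
  qed
  then have "(\<lambda>m. q m + p) \<longlonglongrightarrow> 0 + p"
    by (intro tendsto_add tendsto_const)
  moreover have "measure g {v. x < v $ i} \<le> q m + p" if "1 \<le> m" for m
  proof -
    have "measure g {v. x < v $ i} = measure (g \<Otimes>\<^sub>M M)
        {z \<in> space (g \<Otimes>\<^sub>M M). x < ?X m (fst z) + ?S m (snd z)}"
      using that by (intro invariant_tail_eq[OF inv]) simp
    \<comment> \<open>If the sum exceeds \<open>x\<close>, the initial part exceeds 1 or the noise
      exceeds \<open>x - 1\<close>.\<close>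
    also have "\<dots> \<le> measure (g \<Otimes>\<^sub>M M) ({y \<in> space g. 1 < ?X m y} \<times> space M \<union>
        space g \<times> {\<omega> \<in> space M. x - 1 < ?S m \<omega>})"
      by (intro gM.finite_measure_mono) (auto simp: space_pair_measure)
    also have "\<dots> \<le> measure (g \<Otimes>\<^sub>M M) ({y \<in> space g. 1 < ?X m y} \<times> space M)
        + measure (g \<Otimes>\<^sub>M M) (space g \<times> {\<omega> \<in> space M. x - 1 < ?S m \<omega>})"
      by (intro measure_Un_le) measurable
    also have "\<dots> = q m + prob {\<omega> \<in> space M. x - 1 < ?S m \<omega>}"
      by (simp add: gM.measure_pair_times g.prob_space prob_space q_def)
    finally show ?thesis
      using bound[of m] by linarith
  qed
  ultimately show ?thesis
    by (intro Lim_bounded2[of _ p 1]) auto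
qed

theorem proposition5p3:
  fixes r :: "'e::finite"
    and trib :: "'e \<Rightarrow> 'e set"
    and K H a :: "real^'e"
    and rate \<sigma> :: real
    and \<Omega> :: "'w measure"
    and N :: "real \<Rightarrow> 'w \<Rightarrow> nat"
    and P :: "nat \<Rightarrow> 'w \<Rightarrow> real"
    and g :: "(real^('e + 'e)) measure"
  assumes tree: "rooted_binary_tree r trib"
    and K_pos: "\<And>e. 0 < K $ e"
    and H_pos: "\<And>e. 0 < H $ e"
    and a_pos: "\<And>e. 0 < a $ e"
    and rate_pos: "0 < rate"
    and \<sigma>_pos: "0 < \<sigma>"
    and prob: "prob_space \<Omega>"
    and N: "prob_space.poisson_process \<Omega> rate N"
    and P: "prob_space.rainfall_depths \<Omega> N P"
    and P_exponential: "distributed \<Omega> lborel (P 1) (exponential_density \<sigma>)"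
    and invariant: "invariant_distribution \<Omega> (river_process trib K H a N P) g"
  shows "((\<lambda>x. 1 / x * ln (measure g {v. x < v $ Inl r}))
            \<longlongrightarrow> - \<sigma> / max_response trib K H a r) at_top"
proof -
  interpret prob_space \<Omega>
    by (rule prob)
  interpret poisson_rainfall \<Omega> rate \<sigma> N P
    by unfold_locales (fact rate_pos \<sigma>_pos N P P_exponential)+
  define A where "A = drift_matrix trib K H"
  define b :: "real^('e + 'e)" where "b = block_vector 0 (diag_matrix H *v a)"
  define f where "f = (\<lambda>s. (matrix_exp (s *\<^sub>R A) *v b) $ Inl r)"
  define L where "L = max_response trib K H a r"
  have f_eq: "f = root_response trib K H a r"
    by (simp add: f_def A_def b_def root_response_def fun_eq_iff)
  have inv: "invariant_distribution \<Omega> (shot_noise_state A b N P) g"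
    using invariant by (simp add: river_process_def A_def b_def)
  have metzler: "metzler A"
    unfolding A_def by (rule metzler_drift_matrix[OF K_pos])
  have cont: "continuous_on UNIV f"
    unfolding f_eq by (rule continuous_on_root_response)
  have f_meas: "f \<in> borel_measurable borel"
    by (rule borel_measurable_continuous_onI[OF cont])
  note attained = max_response_attained[OF tree K_pos H_pos a_pos]
  have f_le: "f s \<le> L" if "0 \<le> s" for s
    using attained(2)[OF that] by (simp add: f_eq L_def)
  obtain s where s: "0 \<le> s" "f s = L"
    using attained(1) by (auto simp: f_eq L_def)
  have L_pos: "0 < L"
    using attained(3) by (simp add: L_def)
  have "((\<lambda>x. 1 / x * ln (measure g {v. x < v $ Inl r})) \<longlongrightarrow> - (\<sigma> / L)) at_top"
  proof (rule log_tail_limit)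
    show "0 < \<sigma> / L"
      using \<sigma>_pos L_pos by simp
  next
    fix \<theta> assume \<theta>: "0 < \<theta>" "\<theta> < \<sigma> / L"
    obtain c C where c: "0 < c" "0 < C" 
      "\<And>s. 0 \<le> s \<Longrightarrow> root_response trib K H a r s \<le> C * exp (- c * s)"
      by (rule root_response_decay[OF tree K_pos H_pos a_pos]) (rule that)
    obtain B where B: "\<And>m x. prob {\<omega> \<in> space \<Omega>. x < shot_noise f (real m) \<omega>} \<le> B * exp (- \<theta> * x)"
      using shot_noise_tail_upper[OF f_meas L_pos f_le c(1,2) _ \<theta>(1)] c(3) \<theta>(2) L_pos by (auto simp: f_eq field_simps)
    have decay: "(\<lambda>m. matrix_exp (real m *\<^sub>R A) $ i $ j) \<longlonglongrightarrow> 0" for i j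
    proof -
      obtain c C where c: "0 < c" "0 < C"
        "\<And>s i j. 0 \<le> s \<Longrightarrow>
          matrix_exp (s *\<^sub>R drift_matrix trib K H) $ i $ j \<le> C * exp (- c * s)"
        by (rule drift_matrix_exp_decay[OF tree K_pos H_pos]) (rule that)
      have "(\<lambda>m. C * exp (- c) ^ m) \<longlonglongrightarrow> C * 0"
        using c by (intro tendsto_mult tendsto_const LIMSEQ_realpow_zero) auto
      then have "(\<lambda>m. C * exp (- c * real m)) \<longlonglongrightarrow> 0"
        by (simp add: mult.commute flip: exp_of_nat_mult)
      moreover have "0 \<le> matrix_exp (real m *\<^sub>R A) $ i $ j" for m
        by (rule matrix_exp_nonneg[OF metzler]) simp
      moreover have "matrix_exp (real m *\<^sub>R A) $ i $ j \<le> C * exp (- c * real m)" for m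
        unfolding A_def by (rule c(3)) simp
      ultimately show ?thesis
        by (rule real_tendsto_sandwich[OF always_eventually always_eventually tendsto_const, rotated 2,
            OF _ allI allI])
    qed
    have "measure g {v. x < v $ Inl r} \<le> B * exp \<theta> * exp (- \<theta> * x)" for x
    proof (rule invariant_tail_le[OF inv decay])
      \<comment> \<open>Lowering the threshold by 1 costs only the constant factor
        \<open>exp \<theta>\<close>.\<close>
      have "B * exp (- \<theta> * (x - 1)) = B * exp \<theta> * exp (- \<theta> * x)"
        by (simp add: algebra_simps flip: exp_add)
      then show "prob {\<omega> \<in> space \<Omega>. x - 1 < shot_noise (\<lambda>s. (matrix_exp (s *\<^sub>R A) *v b) $ Inl r) (real m) \<omega>}
          \<le> B * exp \<theta> * exp (- \<theta> * x)" for m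
        using B[of "x - 1" m] by (simp only: f_def)
    qed
    then show "\<exists>C. \<forall>x. measure g {v. x < v $ Inl r} \<le> C * exp (- \<theta> * x)"
      by blast
  next
    fix \<theta> assume \<theta>: "\<sigma> / L < \<theta>"
    \<comment> \<open>This level turns the rate of the one-storm estimate into exactly \<theta>, and
      \<theta> > \<sigma> / L places it strictly below the maximum \<open>f s\<close>.\<close>
    define l where "l = \<sigma> / \<theta>"
    have \<theta>_pos: "0 < \<theta>"
      using \<theta> \<sigma>_pos L_pos by (meson divide_pos_pos less_trans)
    have l: "0 < l" "l < f s" "\<sigma> / l = \<theta>"
      using \<theta> \<theta>_pos \<sigma>_pos L_pos s(2) by (auto simp: l_def field_simps)
    have f_nonneg: "0 \<le> f s" if "0 \<le> s" for s
      unfolding f_eq by (rule root_response_nonneg[OF K_pos H_pos a_pos that])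
    have "isCont f s"
      using cont by (simp add: continuous_on_eq_continuous_at)
    then obtain I c where I: "finite I" "I \<subseteq> {0<..}" "0 < c"
      "\<And>x. 0 \<le> x \<Longrightarrow> c * exp (- (\<sigma> / l) * x) \<le> (\<Sum>t\<in>I. prob {\<omega> \<in> space \<Omega>. x < shot_noise f t \<omega>})"
      using shot_noise_tail_lower[OF f_meas f_nonneg s(1) _ l(1,2)] by blast
    \<comment> \<open>Each grid time is bounded by the same invariant tail, so the sum over the grid
      costs a factor \<open>card I\<close>.\<close>
    have le: "c * exp (- \<theta> * x) \<le> real (card I) * measure g {v. x < v $ Inl r}" if "0 \<le> x" for x
    proof -
      have "(\<Sum>t\<in>I. prob {\<omega> \<in> space \<Omega>. x < shot_noise f t \<omega>}) \<le>
          real (card I) * measure g {v. x < v $ Inl r}"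
        using I(2) by (intro sum_bounded_above)
          (auto simp: f_def intro!: shot_noise_tail_le_invariant_tail[OF inv metzler])
      then show ?thesis
        using I(4)[OF that] l(3) by simp
    qed
    have "0 < card I"
    proof (rule ccontr)
      assume "\<not> 0 < card I"
      then show False
        using le[of 0] I(3) by simp
    qed
    then have "c / card I * exp (- \<theta> * x) \<le> measure g {v. x < v $ Inl r}" if "0 \<le> x" for x
      using le[OF that] by (simp add: field_simps)
    then show "\<exists>c>0. \<forall>x\<ge>0. c * exp (- \<theta> * x) \<le> measure g {v. x < v $ Inl r}"
      using \<open>0 < card I\<close> I(3) by (intro exI[of _ "c / card I"]) simp
  qed
  then show ?thesis
    by (simp add: L_def)
qed

end
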